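(* Let $X$ be a Polish locally Roelcke-precompact group. Then the group $\mathrm{Aut}(X)$ of bicontinuous group automorphisms of $X$ is a Polish group for the lower topology.
   Context: A subset $A$ of a topological group $X$ is Roelcke-precompact if for every identity neighborhood $V$ of $X$ there exists a finite set $F \subseteq X$ such that $A \subseteq VFV$. The group $X$ is locally Roelcke-precompact if it admits a Roelcke-precompact identity neighborhood. A topological group is Polish if its topology is separable and can be defined by a complete metric. A subset $B$ of a topological group $X$ is bounded if for every increasing sequence $V_1 \subseteq V_2 \subseteq \dots$ of open subsets of $X$ with $\bigcup_n V_n = X$ and $V_n^2 \subseteq V_{n+1}$ for all $n$, there is an index $k$ with $B \subseteq V_k$. Roelcke-precompact sets are bounded, so a locally Roelcke-precompact group is locally bounded (admits a bounded identity neighborhood). The lower (Roelcke) uniform structure of $X$ is generated by the entourages $\{(x,y) \mid x \in VyV\}$, where $V$ runs among identity neighborhoods. For $X$ locally bounded, the lower topology on $\mathrm{Aut}(X)$ is the topology of uniform biconvergence on bounded sets with respect to the lower uniform structure of $X$: a net $(g_i)$ converges to $g$ if and only if both $g_i \to g$ and $g_i^{-1} \to g^{-1}$ uniformly on each bounded subset of $X$, with respect to the lower uniform structure. *)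

theory Defs
  imports "HOL-Analysis.Abstract_Metric_Spaces" "HOL-Algebra.Bij" "HOL-Algebra.Coset"
begin

locale topological_group = group G for G :: "('a, 'b) monoid_scheme" (structure) +
  fixes T :: "'a topology"
  assumes topspace_eq: "topspace T = carrier G"
    and continuous_mult: "continuous_map (prod_topology T T) T (\<lambda>(x, y). x \<otimes> y)"
    and continuous_inv: "continuous_map T T (\<lambda>x. inv x)"

definition polish_group :: "('a, 'b) monoid_scheme \<Rightarrow> 'a topology \<Rightarrow> bool" where
  "polish_group G T \<longleftrightarrow>
    topological_group G T \<and> separable_space T \<and> completely_metrizable_space T"

text \<open>Neighborhoods are not required to be open.\<close>

definition identity_nbhd :: "('a, 'b) monoid_scheme \<Rightarrow> 'a topology \<Rightarrow> 'a set \<Rightarrow> bool" where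
  "identity_nbhd G T V \<longleftrightarrow> V \<subseteq> topspace T \<and> (\<exists>U. openin T U \<and> \<one>\<^bsub>G\<^esub> \<in> U \<and> U \<subseteq> V)"

definition roelcke_precompact :: "('a, 'b) monoid_scheme \<Rightarrow> 'a topology \<Rightarrow> 'a set \<Rightarrow> bool" where
  "roelcke_precompact G T A \<longleftrightarrow> A \<subseteq> carrier G \<and>
    (\<forall>V. identity_nbhd G T V \<longrightarrow>
      (\<exists>F. finite F \<and> F \<subseteq> carrier G \<and> A \<subseteq> V <#>\<^bsub>G\<^esub> F <#>\<^bsub>G\<^esub> V))"

definition locally_roelcke_precompact :: "('a, 'b) monoid_scheme \<Rightarrow> 'a topology \<Rightarrow> bool" where
  "locally_roelcke_precompact G T \<longleftrightarrow>
    (\<exists>V. identity_nbhd G T V \<and> roelcke_precompact G T V)"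

text \<open>This is unrelated to boundedness with respect to a metric inducing \<open>T\<close>.\<close>

definition group_bounded :: "('a, 'b) monoid_scheme \<Rightarrow> 'a topology \<Rightarrow> 'a set \<Rightarrow> bool" where
  "group_bounded G T B \<longleftrightarrow> B \<subseteq> carrier G \<and>
    (\<forall>V :: nat \<Rightarrow> 'a set.
      (\<forall>n. openin T (V n)) \<and> (\<forall>n. V n \<subseteq> V (Suc n)) \<and> (\<Union>n. V n) = carrier G \<and>
      (\<forall>n. V n <#>\<^bsub>G\<^esub> V n \<subseteq> V (Suc n))
      \<longrightarrow> (\<exists>k. B \<subseteq> V k))"

text \<open>As \<open>V\<close> ranges over the identity neighborhoods, these sets generate the lower (Roelcke)
  uniform structure.\<close>

definition lower_entourage :: "('a, 'b) monoid_scheme \<Rightarrow> 'a set \<Rightarrow> ('a \<times> 'a) set" where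
  "lower_entourage G V =
    {(x, y) \<in> carrier G \<times> carrier G. x \<in> V <#>\<^bsub>G\<^esub> {y} <#>\<^bsub>G\<^esub> V}"

text \<open>Elements of \<^const>\<open>AutoGroup\<close> are extensional functions on the carrier.\<close>

definition Aut :: "('a, 'b) monoid_scheme \<Rightarrow> 'a topology \<Rightarrow> ('a \<Rightarrow> 'a) monoid" where
  "Aut G T = (AutoGroup G)\<lparr>carrier := {f \<in> auto G. homeomorphic_map T T f}\<rparr>"

definition lower_nbhd ::
  "('a, 'b) monoid_scheme \<Rightarrow> 'a topology \<Rightarrow> 'a set \<Rightarrow> 'a set \<Rightarrow> ('a \<Rightarrow> 'a) \<Rightarrow> ('a \<Rightarrow> 'a) set" where
  "lower_nbhd G T B V g =
    {h \<in> carrier (Aut G T). \<forall>x\<in>B.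
      (h x, g x) \<in> lower_entourage G V \<and>
      (inv_into (carrier G) h x, inv_into (carrier G) g x) \<in> lower_entourage G V}"

text \<open>The topology of uniform biconvergence on bounded sets, as the topology induced by the
  corresponding uniform structure on the automorphism group; \<open>limitin_lower_topology\<close> below
  is the description by convergent nets.\<close>

definition lower_topology :: "('a, 'b) monoid_scheme \<Rightarrow> 'a topology \<Rightarrow> ('a \<Rightarrow> 'a) topology" where
  "lower_topology G T = topology (\<lambda>\<U>. \<U> \<subseteq> carrier (Aut G T) \<and>
    (\<forall>g\<in>\<U>. \<exists>B V. group_bounded G T B \<and> identity_nbhd G T V \<and> lower_nbhd G T B V g \<subseteq> \<U>))"

lemma identity_nbhd_Int:
  assumes "identity_nbhd G T V" "identity_nbhd G T W"
  shows "identity_nbhd G T (V \<inter> W)"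
proof -
  from assms obtain U U' where "openin T U" "\<one>\<^bsub>G\<^esub> \<in> U" "U \<subseteq> V" "openin T U'" "\<one>\<^bsub>G\<^esub> \<in> U'" "U' \<subseteq> W"
    unfolding identity_nbhd_def by blast
  then have "openin T (U \<inter> U') \<and> \<one>\<^bsub>G\<^esub> \<in> U \<inter> U' \<and> U \<inter> U' \<subseteq> V \<inter> W"
    by blast
  then show ?thesis
    using assms unfolding identity_nbhd_def by blast
qed

lemma group_bounded_Un:
  assumes "group_bounded G T A" "group_bounded G T B"
  shows "group_bounded G T (A \<union> B)"
  unfolding group_bounded_def
proof (intro conjI allI impI)
  show "A \<union> B \<subseteq> carrier G"
    using assms unfolding group_bounded_def by blast
next
  fix V :: "nat \<Rightarrow> 'a set"
  assume V: "(\<forall>n. openin T (V n)) \<and> (\<forall>n. V n \<subseteq> V (Suc n)) \<and> (\<Union>n. V n) = carrier G \<and>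
      (\<forall>n. V n <#>\<^bsub>G\<^esub> V n \<subseteq> V (Suc n))"
  obtain k where k: "A \<subseteq> V k"
    using assms(1)[unfolded group_bounded_def, THEN conjunct2, THEN spec, THEN mp, OF V] ..
  obtain l where l: "B \<subseteq> V l"
    using assms(2)[unfolded group_bounded_def, THEN conjunct2, THEN spec, THEN mp, OF V] ..
  have "\<And>n. V n \<subseteq> V (Suc n)"
    using V by simp
  then have "V k \<subseteq> V (max k l)" "V l \<subseteq> V (max k l)"
    by (rule lift_Suc_mono_le; simp)+
  with k l show "\<exists>k. A \<union> B \<subseteq> V k"
    by blast
qed

lemma lower_entourage_mono: "V \<subseteq> W \<Longrightarrow> lower_entourage G V \<subseteq> lower_entourage G W"
  unfolding lower_entourage_def set_mult_def by fast

lemma lower_nbhd_mono: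
  assumes "A \<subseteq> B" "V \<subseteq> W"
  shows "lower_nbhd G T B V g \<subseteq> lower_nbhd G T A W g"
  using assms lower_entourage_mono[OF assms(2), of G] unfolding lower_nbhd_def by blast

lemma istopology_lower:
  "istopology (\<lambda>\<U>. \<U> \<subseteq> carrier (Aut G T) \<and>
    (\<forall>g\<in>\<U>. \<exists>B V. group_bounded G T B \<and> identity_nbhd G T V \<and> lower_nbhd G T B V g \<subseteq> \<U>))"
  (is "istopology ?P")
proof -
  have "?P (S \<inter> S')" if S: "?P S" and S': "?P S'" for S S'
  proof (intro conjI ballI)
    show "S \<inter> S' \<subseteq> carrier (Aut G T)"
      using S by blast
  next
    fix g assume g: "g \<in> S \<inter> S'"
    obtain B V where 1: "group_bounded G T B" "identity_nbhd G T V" "lower_nbhd G T B V g \<subseteq> S"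
      using g S by blast
    obtain B' V' where 2: "group_bounded G T B'" "identity_nbhd G T V'" "lower_nbhd G T B' V' g \<subseteq> S'"
      using g S' by blast
    have "lower_nbhd G T (B \<union> B') (V \<inter> V') g \<subseteq> S \<inter> S'"
      using 1(3) 2(3) lower_nbhd_mono[of B "B \<union> B'" "V \<inter> V'" V G T g]
        lower_nbhd_mono[of B' "B \<union> B'" "V \<inter> V'" V' G T g] by blast
    then show "\<exists>B V. group_bounded G T B \<and> identity_nbhd G T V \<and> lower_nbhd G T B V g \<subseteq> S \<inter> S'"
      using group_bounded_Un[OF 1(1) 2(1)] identity_nbhd_Int[OF 1(2) 2(2)] by blast
  qed
  moreover have "?P (\<Union>\<K>)" if "\<forall>K\<in>\<K>. ?P K" for \<K>
    using that by (intro conjI ballI) (blast, meson Union_iff Union_upper subset_trans)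
  ultimately show ?thesis
    unfolding istopology_def by blast
qed

lemma openin_lower_topology:
  "openin (lower_topology G T) \<U> \<longleftrightarrow> \<U> \<subseteq> carrier (Aut G T) \<and>
    (\<forall>g\<in>\<U>. \<exists>B V. group_bounded G T B \<and> identity_nbhd G T V \<and> lower_nbhd G T B V g \<subseteq> \<U>)"
proof -
  define P where "P = (\<lambda>\<U>. \<U> \<subseteq> carrier (Aut G T) \<and>
    (\<forall>g\<in>\<U>. \<exists>B V. group_bounded G T B \<and> identity_nbhd G T V \<and> lower_nbhd G T B V g \<subseteq> \<U>))"
  have "istopology P"
    unfolding P_def by (rule istopology_lower)
  then have "openin (topology P) = P"
    by (rule topology_inverse')
  moreover have "lower_topology G T = topology P"
    unfolding lower_topology_def P_def by (rule refl)
  ultimately have "openin (lower_topology G T) \<U> = P \<U>"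
    by (simp only:)
  then show ?thesis
    unfolding P_def .
qed

context topological_group
begin

lemma identity_nbhd_carrier: "identity_nbhd G T (carrier G)"
  unfolding identity_nbhd_def by (metis one_closed openin_topspace order_refl topspace_eq)

lemma topspace_lower_topology: "topspace (lower_topology G T) = carrier (Aut G T)"
proof -
  have "group_bounded G T {}"
    unfolding group_bounded_def by simp
  then have "openin (lower_topology G T) (carrier (Aut G T))"
    using identity_nbhd_carrier unfolding openin_lower_topology by (auto simp: lower_nbhd_def)
  moreover have "topspace (lower_topology G T) \<subseteq> carrier (Aut G T)"
    using openin_lower_topology openin_topspace by blast
  ultimately show ?thesis
    using openin_subset by blast
qed

lemma identity_nbhd_square:
  assumes "identity_nbhd G T V"
  obtains W where "identity_nbhd G T W" "W <#> W \<subseteq> V"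
proof -
  obtain U where U: "openin T U" "\<one> \<in> U" "U \<subseteq> V"
    using assms unfolding identity_nbhd_def by blast
  let ?M = "{p \<in> topspace (prod_topology T T). (case p of (x, y) \<Rightarrow> x \<otimes> y) \<in> U}"
  have "openin (prod_topology T T) ?M"
    using continuous_mult U(1) by (rule openin_continuous_map_preimage)
  then have "\<forall>x y. (x, y) \<in> ?M \<longrightarrow>
      (\<exists>P Q. openin T P \<and> openin T Q \<and> x \<in> P \<and> y \<in> Q \<and> P \<times> Q \<subseteq> ?M)"
    unfolding openin_prod_topology_alt .
  moreover have "(\<one>, \<one>) \<in> ?M"
    using U(2) topspace_eq by simp
  ultimately have "\<exists>P Q. openin T P \<and> openin T Q \<and> \<one> \<in> P \<and> \<one> \<in> Q \<and> P \<times> Q \<subseteq> ?M"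
    by (elim allE[where x = \<one>] impE)
  then obtain P Q where PQ: "openin T P" "openin T Q" "\<one> \<in> P" "\<one> \<in> Q" "P \<times> Q \<subseteq> ?M"
    by (elim exE conjE)
  have "identity_nbhd G T (P \<inter> Q)"
    unfolding identity_nbhd_def using PQ(1-4) openin_subset by blast
  moreover have "(P \<inter> Q) <#> (P \<inter> Q) \<subseteq> V"
    using PQ(5) U(3) unfolding set_mult_def by fastforce
  ultimately show thesis
    by (rule that)
qed

lemma identity_nbhdD:
  assumes "identity_nbhd G T V"
  shows "V \<subseteq> carrier G" "\<one> \<in> V"
  using assms topspace_eq unfolding identity_nbhd_def by auto

lemma lower_entourage_refl:
  assumes "identity_nbhd G T V" "x \<in> carrier G"
  shows "(x, x) \<in> lower_entourage G V"
proof -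
  have "x = \<one> \<otimes> x \<otimes> \<one>"
    using assms(2) by simp
  then show ?thesis
    using identity_nbhdD(2)[OF assms(1)] assms(2)
    unfolding lower_entourage_def set_mult_def by blast
qed

lemma lower_entourage_trans:
  assumes W: "W \<subseteq> carrier G" "W <#> W \<subseteq> V"
    and "(x, y) \<in> lower_entourage G W" "(y, z) \<in> lower_entourage G W"
  shows "(x, z) \<in> lower_entourage G V"
proof -
  from assms obtain a b c d where e: "a \<in> W" "b \<in> W" "c \<in> W" "d \<in> W" "x = a \<otimes> y \<otimes> b" "y = c \<otimes> z \<otimes> d"
    and car: "x \<in> carrier G" "z \<in> carrier G"
    unfolding lower_entourage_def set_mult_def by blast
  have "a \<in> carrier G" "b \<in> carrier G" "c \<in> carrier G" "d \<in> carrier G"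
    using e W(1) by auto
  then have "x = (a \<otimes> c) \<otimes> z \<otimes> (d \<otimes> b)"
    using e(5,6) car(2) by (simp add: m_assoc)
  moreover have "a \<otimes> c \<in> V" "d \<otimes> b \<in> V"
    using e W(2) unfolding set_mult_def by blast+
  ultimately show ?thesis
    using car unfolding lower_entourage_def set_mult_def by blast
qed

lemma Aut_apply_closed:
  assumes "g \<in> carrier (Aut G T)" "x \<in> carrier G"
  shows "g x \<in> carrier G" "inv_into (carrier G) g x \<in> carrier G"
  using assms Bij_imp_funcset Bij_inv_into_mem by (fastforce simp: Aut_def auto_def)+

lemma lower_nbhd_self:
  assumes "group_bounded G T B" "identity_nbhd G T V" "g \<in> carrier (Aut G T)"
  shows "g \<in> lower_nbhd G T B V g"
proof -
  have "B \<subseteq> carrier G"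
    using assms(1) unfolding group_bounded_def by blast
  then show ?thesis
    using assms lower_entourage_refl Aut_apply_closed unfolding lower_nbhd_def by blast
qed

lemma lower_nbhd_trans:
  assumes "W \<subseteq> carrier G" "W <#> W \<subseteq> V"
    and "h \<in> lower_nbhd G T B W g" "k \<in> lower_nbhd G T B W h"
  shows "k \<in> lower_nbhd G T B V g"
  unfolding lower_nbhd_def mem_Collect_eq
proof (intro conjI ballI)
  show "k \<in> carrier (Aut G T)"
    using assms(4) unfolding lower_nbhd_def by simp
next
  fix x assume x: "x \<in> B"
  show "(k x, g x) \<in> lower_entourage G V"
    by (rule lower_entourage_trans[OF assms(1,2), of _ "h x"])
      (use assms(3,4) x in \<open>simp_all add: lower_nbhd_def\<close>)
  show "(inv_into (carrier G) k x, inv_into (carrier G) g x) \<in> lower_entourage G V"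
    by (rule lower_entourage_trans[OF assms(1,2), of _ "inv_into (carrier G) h x"])
      (use assms(3,4) x in \<open>simp_all add: lower_nbhd_def\<close>)
qed

lemma lower_nbhd_open_subset:
  assumes B: "group_bounded G T B" and V: "identity_nbhd G T V" and g: "g \<in> carrier (Aut G T)"
  obtains \<U> where "openin (lower_topology G T) \<U>" "g \<in> \<U>" "\<U> \<subseteq> lower_nbhd G T B V g"
proof
  let ?U = "{h \<in> carrier (Aut G T). \<exists>W. identity_nbhd G T W \<and>
    lower_nbhd G T B W h \<subseteq> lower_nbhd G T B V g}"
  show "g \<in> ?U"
    using V g by blast
  show "?U \<subseteq> lower_nbhd G T B V g"
    using lower_nbhd_self[OF B] by blast
  show "openin (lower_topology G T) ?U"
    unfolding openin_lower_topology
  proof (intro conjI ballI)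
    show "?U \<subseteq> carrier (Aut G T)"
      by blast
  next
    fix h assume "h \<in> ?U"
    then obtain W where W: "identity_nbhd G T W" "lower_nbhd G T B W h \<subseteq> lower_nbhd G T B V g"
      by blast
    obtain W' where W': "identity_nbhd G T W'" "W' <#> W' \<subseteq> W"
      using identity_nbhd_square[OF W(1)] .
    have "lower_nbhd G T B W' h \<subseteq> ?U"
    proof
      fix k assume k: "k \<in> lower_nbhd G T B W' h"
      then have "lower_nbhd G T B W' k \<subseteq> lower_nbhd G T B V g"
        using lower_nbhd_trans[OF identity_nbhdD(1)[OF W'(1)] W'(2)] W(2) by blast
      moreover have "k \<in> carrier (Aut G T)"
        using k unfolding lower_nbhd_def by blast
      ultimately show "k \<in> ?U"
        using W'(1) by blast
    qed
    then show "\<exists>B V. group_bounded G T B \<and> identity_nbhd G T V \<and> lower_nbhd G T B V h \<subseteq> ?U"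
      using B W'(1) by blast
  qed
qed

lemma limitin_lower_topology:
  assumes "\<forall>\<^sub>F i in F. f i \<in> carrier (Aut G T)"
  shows "limitin (lower_topology G T) f g F \<longleftrightarrow> g \<in> carrier (Aut G T) \<and>
    (\<forall>B V. group_bounded G T B \<and> identity_nbhd G T V \<longrightarrow>
      (\<forall>\<^sub>F i in F. \<forall>x\<in>B. (f i x, g x) \<in> lower_entourage G V) \<and>
      (\<forall>\<^sub>F i in F. \<forall>x\<in>B.
        (inv_into (carrier G) (f i) x, inv_into (carrier G) g x) \<in> lower_entourage G V))"
    (is "?L \<longleftrightarrow> ?R")
proof
  assume L: ?L
  then have g: "g \<in> carrier (Aut G T)"
    by (simp add: limitin_def topspace_lower_topology)
  have "\<forall>\<^sub>F i in F. f i \<in> lower_nbhd G T B V g"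
    if BV: "group_bounded G T B" "identity_nbhd G T V" for B V
  proof -
    obtain \<U> where U: "openin (lower_topology G T) \<U>" "g \<in> \<U>" "\<U> \<subseteq> lower_nbhd G T B V g"
      using lower_nbhd_open_subset[OF BV g] .
    then have "\<forall>\<^sub>F i in F. f i \<in> \<U>"
      using L by (simp add: limitin_def)
    then show ?thesis
      by (rule eventually_mono) (use U(3) in blast)
  qed
  moreover have "(\<forall>\<^sub>F i in F. \<forall>x\<in>B. (f i x, g x) \<in> lower_entourage G V) \<and>
      (\<forall>\<^sub>F i in F. \<forall>x\<in>B.
        (inv_into (carrier G) (f i) x, inv_into (carrier G) g x) \<in> lower_entourage G V)"
    if "\<forall>\<^sub>F i in F. f i \<in> lower_nbhd G T B V g" for B V
    using that by (intro conjI; elim eventually_mono; simp add: lower_nbhd_def)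
  ultimately show ?R
    using g by simp
next
  assume R: ?R
  show ?L
    unfolding limitin_def
  proof (intro conjI allI impI)
    show "g \<in> topspace (lower_topology G T)"
      using R by (simp add: topspace_lower_topology)
  next
    fix \<U> assume "openin (lower_topology G T) \<U> \<and> g \<in> \<U>"
    then obtain B V where BV: "group_bounded G T B" "identity_nbhd G T V" "lower_nbhd G T B V g \<subseteq> \<U>"
      unfolding openin_lower_topology by blast
    have "\<forall>\<^sub>F i in F. \<forall>x\<in>B. (f i x, g x) \<in> lower_entourage G V"
      "\<forall>\<^sub>F i in F. \<forall>x\<in>B.
        (inv_into (carrier G) (f i) x, inv_into (carrier G) g x) \<in> lower_entourage G V"
      using R BV(1,2) by simp_all
    with assms have "\<forall>\<^sub>F i in F. f i \<in> lower_nbhd G T B V g"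
      unfolding lower_nbhd_def by eventually_elim simp
    then show "\<forall>\<^sub>F i in F. f i \<in> \<U>"
      by (rule eventually_mono) (use BV(3) in blast)
  qed
qed

end

end

theory Submission
  imports Defs "HOL-Analysis.Urysohn"
begin

text \<open>The proof works with the two-sided uniform structure of a topological group, in which a
  sequence \<open>x\<close> is Cauchy if both \<open>x\<^sub>m\<^sup>-\<^sup>1 x\<^sub>n\<close> and \<open>x\<^sub>m x\<^sub>n\<^sup>-\<^sup>1\<close> tend to the identity. A separated
  group with a countable neighborhood base at the identity whose two-sided Cauchy sequences
  converge is completely metrizable (\<open>two_sided_complete_imp_completely_metrizable\<close>), and
  conversely a Baire category argument shows that in a completely metrizable group all two-sided
  Cauchy sequences converge (\<open>completely_metrizable_imp_two_sided_complete\<close>). The first fact is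
  applied to the automorphism group, the second to the group \<open>X\<close> itself.

  Completeness passes from \<open>X\<close> to its automorphism group as follows. The lower uniform structure
  of \<open>X\<close> is usually not complete, so it does not suffice that automorphisms \<open>g\<^sub>n\<close> are
  Cauchy for uniform convergence: their limit could leave \<open>X\<close>. But if \<open>g\<close> is two-sided Cauchy,
  then \<open>g\<^sub>n g\<^sub>N\<^sup>-\<^sup>1\<close> is uniformly close to the identity on a bounded neighborhood of \<open>1\<close>, which makes the maps
  \<open>g\<^sub>n\<close> equicontinuous at \<open>1\<close>; and \<open>g\<^sub>m\<^sup>-\<^sup>1 g\<^sub>n x\<close> tends to the point \<open>x\<close> of \<open>X\<close>, where the
  lower uniform structure induces the original topology. Applying the equicontinuous maps
  \<open>g\<^sub>m\<close> to \<open>x\<^sup>-\<^sup>1 (g\<^sub>m\<^sup>-\<^sup>1 g\<^sub>n x)\<close> shows that \<open>g\<^sub>n x\<close> is two-sided Cauchy in \<open>X\<close>, hence converges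
  in \<open>X\<close>. The same holds for the inverses, and the two limit maps are mutually inverse continuous
  homomorphisms (\<open>Aut_two_sided_complete\<close>).

  Local Roelcke precompactness enters through the fact that in its presence a product of two
  Roelcke-precompact sets is Roelcke-precompact (\<open>roelcke_precompact_mult\<close>). With
  separability this yields a sequence of Roelcke-precompact sets that absorbs every bounded
  set (\<open>roelcke_precompact_exhaustion\<close>). Hence the lower topology has a countable base at the
  identity. It is also separable, because on a Roelcke-precompact set an automorphism is determined
  up to a prescribed error by its modulus of continuity at \<open>1\<close> and by approximate values at
  finitely many points, and these data range over a countable set (\<open>Aut_separable\<close>).\<close>

section \<open>Metrization of a countable uniform structure\<close>

text \<open>For a nonnegative symmetric \<open>f\<close> the infimum of the lengths \<open>s\<close> is the largest pseudometric below
  \<open>f\<close>. The number \<open>n\<close> of links serves as the induction measure in the estimate of this infimum from below.\<close>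

inductive chain :: "'a set \<Rightarrow> ('a \<Rightarrow> 'a \<Rightarrow> real) \<Rightarrow> nat \<Rightarrow> 'a \<Rightarrow> 'a \<Rightarrow> real \<Rightarrow> bool"
  for M f where
  chain_refl: "x \<in> M \<Longrightarrow> chain M f 0 x x 0"
| chain_step: "chain M f n x y s \<Longrightarrow> z \<in> M \<Longrightarrow> chain M f (Suc n) x z (s + f y z)"

lemma chain_in: "chain M f n x y s \<Longrightarrow> x \<in> M \<and> y \<in> M"
  by (induction rule: chain.induct) auto

lemma chain_nonneg:
  assumes "\<And>x y. 0 \<le> f x y"
  shows "chain M f n x y s \<Longrightarrow> 0 \<le> s"
  by (induction rule: chain.induct) (auto simp: assms)

lemma chain_link: "x \<in> M \<Longrightarrow> y \<in> M \<Longrightarrow> chain M f 1 x y (f x y)"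
  using chain_step[OF chain_refl[of x M f], of y] by simp

lemma chain_append:
  "chain M f n y z b \<Longrightarrow> chain M f m x y a \<Longrightarrow> chain M f (m + n) x z (a + b)"
proof (induction n y z b rule: chain.induct)
  case (chain_step n y y' s z)
  then show ?case
    using chain.chain_step[of M f "m + n" x y' "a + s" z] by (simp add: add.assoc)
qed simp

lemma chain_reverse:
  assumes sym: "\<And>x y. f x y = f y x"
  shows "chain M f n x y s \<Longrightarrow> chain M f n y x s"
proof (induction rule: chain.induct)
  case (chain_step n x y s z)
  have "chain M f 1 z y (f z y)"
    using chain_link chain_in[OF chain_step(1)] chain_step(2) by metis
  then have "chain M f (1 + n) z x (f z y + s)"
    using chain_step.IH by (rule chain_append[rotated])
  then show ?case
    by (simp add: sym[of z y] add.commute)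
qed (simp add: chain_refl)

text \<open>The link to cut out is one at which the length along the chain passes \<open>t\<close>. With \<open>t = s / 2\<close> both
  remaining pieces are shorter chains of at most half the length, which is what the induction in the metrization theorem needs.\<close>

lemma chain_split:
  assumes "chain M f n x y s" "0 < n" "0 \<le> t" "t \<le> s"
  shows "\<exists>k a u v l b. chain M f k x u a \<and> chain M f l v y b \<and> k < n \<and> l < n \<and>
    a + f u v + b = s \<and> a \<le> t \<and> b \<le> s - t"
  using assms
proof (induction n x y s rule: chain.induct)
  case (chain_step n x y s z)
  note in_M = chain_in[OF chain_step(1)]
  show ?case
  proof (cases "s \<le> t")
    case True
    moreover have "chain M f 0 z z 0"
      using chain_step(2) by (rule chain_refl)
    ultimately show ?thesis
      using chain_step.prems chain_step(1) by fastforce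
  next
    case False
    then have "0 < n"
      using chain_step(1) chain_step.prems by (auto elim: chain.cases)
    then obtain k a u v l b where c: "chain M f k x u a" "chain M f l v y b" "k < n" "l < n"
        "a + f u v + b = s" "a \<le> t" "b \<le> s - t"
      using chain_step.IH chain_step.prems False by auto
    have "chain M f (Suc l) v z (b + f y z)"
      using c(2) chain_step(2) by (rule chain.chain_step)
    moreover have "a + f u v + (b + f y z) = s + f y z" "b + f y z \<le> s + f y z - t"
      using c by auto
    ultimately show ?thesis
      using c(1,3,4,6) by (meson Suc_mono less_SucI)
  qed
qed simp

text \<open>The metrization lemma for uniform structures with a countable base. The relations \<open>E n\<close> give a crude
  distance \<open>f\<close> with values \<open>0\<close> and powers of \<open>1/2\<close>, and the metric is the infimum of the \<open>f\<close>-lengths of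
  chains. Composition of three relations \<open>E (Suc n)\<close> in \<open>E n\<close> says that \<open>f\<close> at most doubles along
  three links, and this propagates to chains of any length.\<close>

theorem countable_uniformity_metric:
  fixes E :: "nat \<Rightarrow> 'a \<Rightarrow> 'a \<Rightarrow> bool"
  assumes refl: "\<And>n x. x \<in> M \<Longrightarrow> E n x x"
    and sym: "\<And>n x y. E n x y \<Longrightarrow> E n y x"
    and comp: "\<And>n x y z w. \<lbrakk>x \<in> M; y \<in> M; z \<in> M; w \<in> M; E (Suc n) x y; E (Suc n) y z; E (Suc n) z w\<rbrakk>
      \<Longrightarrow> E n x w"
    and sep: "\<And>x y. \<lbrakk>x \<in> M; y \<in> M; \<And>n. E n x y\<rbrakk> \<Longrightarrow> x = y"
  obtains d where "Metric_space M d"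
    and "\<And>n x y. \<lbrakk>x \<in> M; y \<in> M; d x y < (1/2) ^ Suc n\<rbrakk> \<Longrightarrow> E n x y"
    and "\<And>n x y. \<lbrakk>x \<in> M; y \<in> M; E n x y\<rbrakk> \<Longrightarrow> d x y < (1/2) ^ n"
proof -
  define f :: "'a \<Rightarrow> 'a \<Rightarrow> real" where
    "f x y = (if \<forall>n. E n x y then 0 else (1/2) ^ (LEAST n. \<not> E n x y))" for x y
  have sym_iff: "E n x y = E n y x" for n x y
    using sym by blast
  have f_nonneg: "0 \<le> f x y" for x y
    by (simp add: f_def)
  have f_sym: "f x y = f y x" for x y
    by (simp add: f_def sym_iff[of _ x y])
  have E_Suc: "E n x y" if "E (Suc n) x y" "x \<in> M" "y \<in> M" for n x y
    using comp[of x x y y n] that refl by blast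
  have E_le: "E m x y" if "E n x y" "m \<le> n" "x \<in> M" "y \<in> M" for m n x y
    using that(2,1) by (induction n rule: dec_induct) (use E_Suc that(3,4) in auto)
  \<comment> \<open>The first index at which the decreasing relations fail is the exponent of \<open>f x y\<close>.\<close>
  have f_less: "f x y < (1/2) ^ n \<longleftrightarrow> E n x y" if "x \<in> M" "y \<in> M" for n x y
  proof (cases "\<forall>n. E n x y")
    case False
    define k where "k = (LEAST n. \<not> E n x y)"
    have k: "\<not> E k x y" "\<And>m. m < k \<Longrightarrow> E m x y"
      unfolding k_def using False by (metis LeastI) (metis not_less_Least)
    have "E n x y \<longleftrightarrow> n < k"
      using k E_le that by (meson not_less)
    moreover have "f x y = (1/2) ^ k"
      using False by (simp add: f_def k_def)
    ultimately show ?thesis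
      by (simp add: power_strict_decreasing_iff)
  qed (simp add: f_def)
  \<comment> \<open>Half of \<open>f\<close> is thus a lower bound for the infimum over chains.\<close>
  have f_chain: "f x y \<le> 2 * s" if "chain M f n x y s" for n x y s
    using that
  proof (induction n arbitrary: x y s rule: less_induct)
    case (less n)
    have s0: "0 \<le> s"
      using chain_nonneg[of f, OF f_nonneg less.prems] .
    show ?case
    proof (cases "n = 0")
      case True
      with less.prems have "x = y" "x \<in> M"
        by (auto elim: chain.cases)
      then show ?thesis
        using s0 refl by (simp add: f_def)
    next
      case False
      then obtain k a u v l b where c: "chain M f k x u a" "chain M f l v y b" "k < n" "l < n"
          "a + f u v + b = s" "a \<le> s / 2" "b \<le> s - s / 2"
        using chain_split[OF less.prems, of "s / 2"] s0 by auto
      have in_M: "x \<in> M" "u \<in> M" "v \<in> M" "y \<in> M"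
        using chain_in[OF c(1)] chain_in[OF c(2)] by auto
      have "0 \<le> a" "0 \<le> b"
        using chain_nonneg[of f, OF f_nonneg] c(1,2) by blast+
      then have pieces: "f x u \<le> s" "f u v \<le> s" "f v y \<le> s"
        using less.IH[OF c(3,1)] less.IH[OF c(4,2)] c(5-7) by auto
      show ?thesis
      proof (rule ccontr)
        \<comment> \<open>If \<open>f x y = (1/2) ^ m\<close> exceeds \<open>2 * s\<close>, then all three pieces lie in \<open>E (Suc m)\<close>, which forces
          \<open>E m x y\<close> and so \<open>f x y < (1/2) ^ m\<close>.\<close>
        assume "\<not> f x y \<le> 2 * s"
        then have big: "2 * s < f x y"
          by simp
        then obtain m where m: "f x y = (1/2) ^ m"
          using s0 by (auto simp: f_def split: if_splits)
        then have "s < (1/2) ^ Suc m"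
          using big by simp
        then have "E (Suc m) x u" "E (Suc m) u v" "E (Suc m) v y"
          using pieces f_less in_M by (meson order_le_less_trans)+
        then have "f x y < (1/2) ^ m"
          using comp in_M f_less by blast
        then show False
          using m by simp
      qed
    qed
  qed
  define d where "d x y = (if x \<in> M \<and> y \<in> M then Inf {s. \<exists>n. chain M f n x y s} else 0)" for x y
  have bdd: "bdd_below {s. \<exists>n. chain M f n x y s}" for x y
    using chain_nonneg[of f, OF f_nonneg] by (auto intro: bdd_belowI[of _ 0])
  have d_le: "d x y \<le> s" if "chain M f n x y s" for n x y s
    using chain_in[OF that] bdd that by (auto simp: d_def intro: cInf_lower)
  have d_ge: "c \<le> d x y" if "x \<in> M" "y \<in> M" "\<And>n s. chain M f n x y s \<Longrightarrow> c \<le> s" for c x y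
    using that chain_link[of x M y f] by (auto simp: d_def intro!: cInf_greatest)
  have d_le_f: "d x y \<le> f x y" if "x \<in> M" "y \<in> M" for x y
    using d_le chain_link that by fast
  have f_le_d: "f x y \<le> 2 * d x y" if "x \<in> M" "y \<in> M" for x y
    using d_ge[OF that, of "f x y / 2"] f_chain by force
  have metric: "Metric_space M d"
  proof
    show "0 \<le> d x y" for x y
    proof (cases "x \<in> M \<and> y \<in> M")
      case True
      then show ?thesis
        using f_le_d[of x y] f_nonneg[of x y] by simp
    qed (auto simp: d_def)
    have "chain M f n x y s \<longleftrightarrow> chain M f n y x s" for n x y s
      using chain_reverse[of f, OF f_sym] by blast
    then show "d x y = d y x" for x y
      by (simp add: d_def conj_commute)
    show "d x y = 0 \<longleftrightarrow> x = y" if "x \<in> M" "y \<in> M" for x y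
    proof
      assume "d x y = 0"
      then have "f x y < (1/2) ^ n" for n
        using f_le_d[OF that] by (simp add: order_le_less_trans)
      then show "x = y"
        using f_less sep that by blast
    next
      assume "x = y"
      then show "d x y = 0"
        using d_le[OF chain_refl[OF that(1)]] f_le_d[OF that] f_nonneg[of x y] by simp
    qed
    show "d x z \<le> d x y + d y z" if in_M: "x \<in> M" "y \<in> M" "z \<in> M" for x y z
    proof -
      have "d x z - a \<le> d y z" if "chain M f m x y a" for m a
        using d_ge[OF in_M(2,3), of "d x z - a"] d_le[OF chain_append[OF _ that]] by force
      then have "d x z - d y z \<le> d x y"
        using d_ge[OF in_M(1,2), of "d x z - d y z"] by force
      then show ?thesis
        by simp
    qed
  qed
  show thesis
  proof (rule that[OF metric])
    show "E n x y" if "x \<in> M" "y \<in> M" "d x y < (1/2) ^ Suc n" for n x y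
      using f_le_d[OF that(1,2)] that f_less[OF that(1,2), of n] by simp
    show "d x y < (1/2) ^ n" if "x \<in> M" "y \<in> M" "E n x y" for n x y
      using d_le_f[OF that(1,2)] that(3) f_less[OF that(1,2), of n] by simp
  qed
qed

section \<open>Neighborhoods of the identity in a topological group\<close>

context topological_group
begin

lemma inv_cancel_left:
  "x \<in> carrier G \<Longrightarrow> y \<in> carrier G \<Longrightarrow> x \<otimes> (inv x \<otimes> y) = y"
  "x \<in> carrier G \<Longrightarrow> y \<in> carrier G \<Longrightarrow> inv x \<otimes> (x \<otimes> y) = y"
  by (simp_all add: m_assoc[symmetric])

lemma in_topspace_iff [simp]: "x \<in> topspace T \<longleftrightarrow> x \<in> carrier G"
  by (simp add: topspace_eq)

lemma openin_carrier: "openin T U \<Longrightarrow> U \<subseteq> carrier G"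
  using openin_subset topspace_eq by blast

lemma continuous_map_mult:
  assumes "continuous_map X T f" "continuous_map X T g"
  shows "continuous_map X T (\<lambda>x. f x \<otimes> g x)"
proof -
  have "continuous_map X (prod_topology T T) (\<lambda>x. (f x, g x))"
    using assms by (simp add: continuous_map_pairwise o_def)
  from continuous_map_compose[OF this continuous_mult] show ?thesis
    by (simp add: o_def)
qed

lemma continuous_map_inv: "continuous_map X T f \<Longrightarrow> continuous_map X T (\<lambda>x. inv (f x))"
  using continuous_map_compose[OF _ continuous_inv, of X f] by (simp add: o_def)

lemma continuous_map_point: "a \<in> carrier G \<Longrightarrow> continuous_map X T (\<lambda>x. a)"
  by simp

lemma continuous_map_self: "continuous_map T T (\<lambda>x. x)"
  by simp

lemmas continuous_map_group =
  continuous_map_mult continuous_map_inv continuous_map_point continuous_map_self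

text \<open>Used with words in one variable and constants as \<open>f\<close>: every such continuous condition on a
  group element that holds at the identity holds on an identity neighborhood.\<close>

lemma identity_nbhd_vimage_open:
  assumes "continuous_map T T f" "openin T U" "f \<one> \<in> U"
  shows "identity_nbhd G T {y \<in> carrier G. f y \<in> U}"
  using openin_continuous_map_preimage[OF assms(1,2)] assms(3) topspace_eq
  unfolding identity_nbhd_def by auto

lemma identity_nbhd_mono:
  "identity_nbhd G T V \<Longrightarrow> V \<subseteq> W \<Longrightarrow> W \<subseteq> carrier G \<Longrightarrow> identity_nbhd G T W"
  using topspace_eq unfolding identity_nbhd_def by blast

lemma identity_nbhd_vimage:
  assumes "continuous_map T T f" "identity_nbhd G T V" "f \<one> = \<one>"
  shows "identity_nbhd G T {y \<in> carrier G. f y \<in> V}"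
proof -
  obtain U where U: "openin T U" "\<one> \<in> U" "U \<subseteq> V"
    using assms(2) unfolding identity_nbhd_def by blast
  then have "identity_nbhd G T {y \<in> carrier G. f y \<in> U}"
    using assms by (simp add: identity_nbhd_vimage_open)
  then show ?thesis
    by (rule identity_nbhd_mono) (use U in auto)
qed

lemma openin_imp_identity_nbhd: "openin T U \<Longrightarrow> \<one> \<in> U \<Longrightarrow> identity_nbhd G T U"
  using openin_subset unfolding identity_nbhd_def by blast

lemma identity_nbhd_conjugate:
  assumes "identity_nbhd G T V" "a \<in> carrier G"
  shows "identity_nbhd G T {y \<in> carrier G. inv a \<otimes> y \<otimes> a \<in> V}"
  using assms by (intro identity_nbhd_vimage continuous_map_group) simp_all

lemma identity_nbhd_symmetric_square:
  assumes "identity_nbhd G T V"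
  obtains W where "identity_nbhd G T W" "W \<subseteq> V" "\<And>a. a \<in> W \<Longrightarrow> inv a \<in> W"
    "\<And>a b. a \<in> W \<Longrightarrow> b \<in> W \<Longrightarrow> a \<otimes> b \<in> V"
proof -
  obtain U where U: "identity_nbhd G T U" "U <#> U \<subseteq> V"
    using identity_nbhd_square[OF assms] .
  have inv: "identity_nbhd G T {y \<in> carrier G. inv y \<in> U}"
    using U(1) by (intro identity_nbhd_vimage continuous_map_group) simp_all
  let ?W = "U \<inter> {y \<in> carrier G. inv y \<in> U}"
  have prod: "a \<otimes> b \<in> V" if "a \<in> ?W" "b \<in> ?W" for a b
    using that U(2) unfolding set_mult_def by blast
  have W: "identity_nbhd G T ?W"
    using U(1) inv by (rule identity_nbhd_Int)
  moreover have "?W \<subseteq> V"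
  proof
    fix a assume "a \<in> ?W"
    then show "a \<in> V"
      using prod[of a \<one>] identity_nbhdD(2)[OF W] by auto
  qed
  moreover have "inv a \<in> ?W" if "a \<in> ?W" for a
    using that by auto
  ultimately show thesis
    using prod that by blast
qed

lemma identity_nbhd_symmetric_cube:
  assumes "identity_nbhd G T V"
  obtains W where "identity_nbhd G T W" "W \<subseteq> V" "\<And>a. a \<in> W \<Longrightarrow> inv a \<in> W"
    "\<And>a b c. a \<in> W \<Longrightarrow> b \<in> W \<Longrightarrow> c \<in> W \<Longrightarrow> a \<otimes> b \<otimes> c \<in> V"
proof -
  obtain V' where V': "identity_nbhd G T V'" "V' \<subseteq> V" "\<And>a b. a \<in> V' \<Longrightarrow> b \<in> V' \<Longrightarrow> a \<otimes> b \<in> V"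
    using identity_nbhd_symmetric_square[OF assms] by metis
  obtain W where W: "identity_nbhd G T W" "W \<subseteq> V'" "\<And>a. a \<in> W \<Longrightarrow> inv a \<in> W"
      "\<And>a b. a \<in> W \<Longrightarrow> b \<in> W \<Longrightarrow> a \<otimes> b \<in> V'"
    using identity_nbhd_symmetric_square[OF V'(1)] by metis
  show thesis
    by (rule that[OF W(1) _ W(3)]) (use V' W in auto)
qed

lemma openin_left_translate:
  assumes "openin T U" "a \<in> carrier G"
  shows "openin T {y \<in> carrier G. a \<otimes> y \<in> U}"
  using openin_continuous_map_preimage[OF _ assms(1), of T "\<lambda>y. a \<otimes> y"] assms(2)
  by (simp add: continuous_map_group)

text \<open>Open sets and limits are expressed through differences \<open>inv x \<otimes> y\<close>, so that all later
  estimates take place near the identity.\<close>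

lemma openin_iff_identity_nbhd:
  "openin T U \<longleftrightarrow> U \<subseteq> carrier G \<and>
    (\<forall>x\<in>U. \<exists>V. identity_nbhd G T V \<and> (\<forall>y\<in>carrier G. inv x \<otimes> y \<in> V \<longrightarrow> y \<in> U))"
  (is "?L \<longleftrightarrow> ?R")
proof
  assume U: ?L
  show ?R
  proof (intro conjI ballI)
    show "U \<subseteq> carrier G"
      using U by (rule openin_carrier)
    fix x assume x: "x \<in> U"
    then have xG: "x \<in> carrier G"
      using U openin_carrier by blast
    have "identity_nbhd G T {y \<in> carrier G. x \<otimes> y \<in> U}"
      using U x xG by (intro identity_nbhd_vimage_open continuous_map_group) simp_all
    moreover have "y \<in> U" if "y \<in> carrier G" "x \<otimes> (inv x \<otimes> y) \<in> U" for y
      using that xG by (simp add: m_assoc[symmetric])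
    ultimately show "\<exists>V. identity_nbhd G T V \<and> (\<forall>y\<in>carrier G. inv x \<otimes> y \<in> V \<longrightarrow> y \<in> U)"
      by (intro exI[of _ "{y \<in> carrier G. x \<otimes> y \<in> U}"]) simp
  qed
next
  assume R: ?R
  show ?L
  proof (subst openin_subopen, intro ballI)
    fix x assume x: "x \<in> U"
    then obtain V where V: "identity_nbhd G T V" "\<And>y. y \<in> carrier G \<Longrightarrow> inv x \<otimes> y \<in> V \<Longrightarrow> y \<in> U"
      using R by blast
    have xG: "x \<in> carrier G"
      using R x by blast
    obtain O' where O': "openin T O'" "\<one> \<in> O'" "O' \<subseteq> V"
      using V(1) unfolding identity_nbhd_def by blast
    have "openin T {y \<in> carrier G. inv x \<otimes> y \<in> O'}"
      using O'(1) xG by (simp add: openin_left_translate)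
    moreover have "x \<in> {y \<in> carrier G. inv x \<otimes> y \<in> O'}" "{y \<in> carrier G. inv x \<otimes> y \<in> O'} \<subseteq> U"
      using O' V(2) xG by auto
    ultimately show "\<exists>S. openin T S \<and> x \<in> S \<and> S \<subseteq> U"
      by blast
  qed
qed

lemma limitin_iff_identity_nbhd:
  assumes "\<And>n. f n \<in> carrier G"
  shows "limitin T f l F \<longleftrightarrow> l \<in> carrier G \<and>
    (\<forall>V. identity_nbhd G T V \<longrightarrow> (\<forall>\<^sub>F n in F. inv l \<otimes> f n \<in> V))" (is "?L \<longleftrightarrow> ?R")
proof
  assume L: ?L
  then have l: "l \<in> carrier G"
    using limitin_topspace by fastforce
  show ?R
  proof (intro conjI allI impI l)
    fix V assume "identity_nbhd G T V"
    then obtain O' where O': "openin T O'" "\<one> \<in> O'" "O' \<subseteq> V"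
      unfolding identity_nbhd_def by blast
    have "openin T {y \<in> carrier G. inv l \<otimes> y \<in> O'}"
      using O'(1) l by (simp add: openin_left_translate)
    moreover have "l \<in> {y \<in> carrier G. inv l \<otimes> y \<in> O'}"
      using l O' by simp
    ultimately have "\<forall>\<^sub>F n in F. f n \<in> {y \<in> carrier G. inv l \<otimes> y \<in> O'}"
      using L unfolding limitin_def by blast
    then show "\<forall>\<^sub>F n in F. inv l \<otimes> f n \<in> V"
      by (rule eventually_mono) (use O' in auto)
  qed
next
  assume R: ?R
  show ?L
    unfolding limitin_def
  proof (intro conjI allI impI)
    show "l \<in> topspace T"
      using R by simp
    fix U assume "openin T U \<and> l \<in> U"
    then obtain V where V: "identity_nbhd G T V" "\<And>y. y \<in> carrier G \<Longrightarrow> inv l \<otimes> y \<in> V \<Longrightarrow> y \<in> U"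
      unfolding openin_iff_identity_nbhd by blast
    then have "\<forall>\<^sub>F n in F. inv l \<otimes> f n \<in> V"
      using R by blast
    then show "\<forall>\<^sub>F n in F. f n \<in> U"
      by (rule eventually_mono) (use V(2) assms in blast)
  qed
qed

lemma limitin_mult:
  assumes "limitin T f l F" "limitin T g k F"
  shows "limitin T (\<lambda>n. f n \<otimes> g n) (l \<otimes> k) F"
proof -
  have "limitin (prod_topology T T) (\<lambda>n. (f n, g n)) (l, k) F"
    using assms by (simp add: limitin_pairwise o_def)
  from continuous_map_limit[OF continuous_mult this] show ?thesis
    by (simp add: o_def)
qed

lemma hom_group_hom: "f \<in> hom G G \<Longrightarrow> group_hom G G f"
  by unfold_locales

lemma hom_continuous_map:
  assumes h: "h \<in> hom G G"
    and V: "\<And>V. identity_nbhd G T V \<Longrightarrow> \<exists>W. identity_nbhd G T W \<and> (\<forall>w\<in>W. h w \<in> V)"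
  shows "continuous_map T T h"
  unfolding continuous_map_def
proof (intro conjI allI impI)
  show "h \<in> topspace T \<rightarrow> topspace T"
    using h by (auto simp: hom_def)
  fix U assume U: "openin T U"
  have "\<exists>W. identity_nbhd G T W \<and> (\<forall>y\<in>carrier G. inv x \<otimes> y \<in> W \<longrightarrow> y \<in> carrier G \<and> h y \<in> U)"
    if x: "x \<in> carrier G" "h x \<in> U" for x
  proof -
    obtain V where "identity_nbhd G T V" "\<And>y. y \<in> carrier G \<Longrightarrow> inv (h x) \<otimes> y \<in> V \<Longrightarrow> y \<in> U"
      using U x(2) unfolding openin_iff_identity_nbhd by blast
    moreover obtain W where "identity_nbhd G T W" "\<And>w. w \<in> W \<Longrightarrow> h w \<in> V"
      using V[OF \<open>identity_nbhd G T V\<close>] by blast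
    moreover have "inv (h x) \<otimes> h y = h (inv x \<otimes> y)" if "y \<in> carrier G" for y
    proof -
      interpret group_hom G G h
        using h by (rule hom_group_hom)
      show ?thesis
        using x(1) that by simp
    qed
    moreover have "h y \<in> carrier G" if "y \<in> carrier G" for y
      using h that by (auto simp: hom_def)
    ultimately show ?thesis
      by metis
  qed
  then show "openin T {x \<in> topspace T. h x \<in> U}"
    unfolding openin_iff_identity_nbhd by simp
qed

lemma separated_imp_eq:
  assumes "\<And>x. x \<in> carrier G \<Longrightarrow> (\<And>V. identity_nbhd G T V \<Longrightarrow> x \<in> V) \<Longrightarrow> x = \<one>"
    and "x \<in> carrier G" "y \<in> carrier G" "\<And>V. identity_nbhd G T V \<Longrightarrow> inv x \<otimes> y \<in> V"
  shows "x = y"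
  using assms(1)[of "inv x \<otimes> y"] assms(2-4) by (metis inv_closed inv_equality inv_inv m_closed)

text \<open>The closure of \<open>W\<close> is contained in \<open>W <#> W\<close> when \<open>W\<close> is symmetric: if \<open>f n\<close> and \<open>inv l \<otimes> f n\<close> are both
  in \<open>W\<close>, then so are the two factors of \<open>l = f n \<otimes> inv (inv l \<otimes> f n)\<close>.\<close>

lemma limitin_in_nbhd:
  assumes lim: "limitin T f l F" "F \<noteq> bot" and f: "\<And>n. f n \<in> carrier G"
    and W: "identity_nbhd G T W" "\<And>a. a \<in> W \<Longrightarrow> inv a \<in> W" "\<And>a b. a \<in> W \<Longrightarrow> b \<in> W \<Longrightarrow> a \<otimes> b \<in> V"
    and ev: "\<forall>\<^sub>F n in F. f n \<in> W"
  shows "l \<in> V"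
proof -
  have l: "l \<in> carrier G" "\<forall>\<^sub>F n in F. inv l \<otimes> f n \<in> W"
    using lim(1) W(1) unfolding limitin_iff_identity_nbhd[of f, OF f] by blast+
  from l(2) ev have "\<forall>\<^sub>F n in F. inv l \<otimes> f n \<in> W \<and> f n \<in> W"
    by eventually_elim simp
  then obtain n where n: "inv l \<otimes> f n \<in> W" "f n \<in> W"
    using eventually_happens'[OF lim(2)] by blast
  have "f n \<otimes> inv (inv l \<otimes> f n) = l"
    using l(1) f[of n] by (simp add: inv_mult_group m_assoc[symmetric])
  then show ?thesis
    using W(3)[OF n(2) W(2)[OF n(1)]] by simp
qed

lemma nbhd_base_of_metrizable:
  assumes "metrizable_space T"
  obtains N :: "nat \<Rightarrow> 'a set" where "\<And>n. identity_nbhd G T (N n)"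
    "\<And>V. identity_nbhd G T V \<Longrightarrow> \<exists>n. N n \<subseteq> V"
proof -
  have "first_countable T"
    using assms by (rule metrizable_imp_first_countable)
  then obtain \<B> where \<B>: "countable \<B>" "\<And>V. V \<in> \<B> \<Longrightarrow> openin T V"
      "\<And>U. openin T U \<Longrightarrow> \<one> \<in> U \<Longrightarrow> \<exists>V\<in>\<B>. \<one> \<in> V \<and> V \<subseteq> U"
    unfolding first_countable_def by (metis in_topspace_iff one_closed)
  let ?\<C> = "{V \<in> \<B>. \<one> \<in> V}"
  have ne: "?\<C> \<noteq> {}"
    using \<B>(3)[of "topspace T"] by auto
  have "countable ?\<C>"
    using \<B>(1) by simp
  then have range: "range (from_nat_into ?\<C>) = ?\<C>"
    using ne by (rule range_from_nat_into[rotated])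
  show thesis
  proof
    show "identity_nbhd G T (from_nat_into ?\<C> n)" for n
      using from_nat_into[OF ne, of n] \<B>(2) by (simp add: openin_imp_identity_nbhd)
    show "\<exists>n. from_nat_into ?\<C> n \<subseteq> V" if V: "identity_nbhd G T V" for V
    proof -
      obtain U where "openin T U" "\<one> \<in> U" "U \<subseteq> V"
        using V unfolding identity_nbhd_def by blast
      then obtain C where "C \<in> ?\<C>" "C \<subseteq> V"
        using \<B>(3)[of U] by blast
      then have "C \<in> range (from_nat_into ?\<C>)"
        using range by simp
      then show ?thesis
        using \<open>C \<subseteq> V\<close> by auto
    qed
  qed
qed

end

section \<open>Two-sided completeness\<close>

definition two_sided_Cauchy :: "('a, 'b) monoid_scheme \<Rightarrow> 'a topology \<Rightarrow> (nat \<Rightarrow> 'a) \<Rightarrow> bool" where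
  "two_sided_Cauchy G T \<sigma> \<longleftrightarrow> range \<sigma> \<subseteq> carrier G \<and>
    (\<forall>V. identity_nbhd G T V \<longrightarrow> (\<exists>N. \<forall>m\<ge>N. \<forall>n\<ge>N.
      inv\<^bsub>G\<^esub> (\<sigma> m) \<otimes>\<^bsub>G\<^esub> \<sigma> n \<in> V \<and> \<sigma> m \<otimes>\<^bsub>G\<^esub> inv\<^bsub>G\<^esub> (\<sigma> n) \<in> V))"

context topological_group
begin

lemma two_sided_CauchyD:
  assumes "two_sided_Cauchy G T \<sigma>"
  shows "\<sigma> n \<in> carrier G"
    and "identity_nbhd G T V \<Longrightarrow> \<exists>N. \<forall>m\<ge>N. \<forall>n\<ge>N. inv (\<sigma> m) \<otimes> \<sigma> n \<in> V"
    and "identity_nbhd G T V \<Longrightarrow> \<exists>N. \<forall>m\<ge>N. \<forall>n\<ge>N. \<sigma> m \<otimes> inv (\<sigma> n) \<in> V"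
  using assms unfolding two_sided_Cauchy_def by blast+

lemma two_sided_Cauchy_inv:
  assumes "two_sided_Cauchy G T \<sigma>"
  shows "two_sided_Cauchy G T (\<lambda>n. inv (\<sigma> n))"
  using assms two_sided_CauchyD(1)[OF assms] unfolding two_sided_Cauchy_def
  by (simp add: image_subset_iff) blast

text \<open>The metric comes from the two-sided uniform structure, so it need not be invariant, but its Cauchy
  sequences are exactly the two-sided ones. A left-invariant metric would have more Cauchy
  sequences, and these need not converge even in a Polish group.\<close>

theorem two_sided_complete_imp_completely_metrizable:
  assumes N: "\<And>n. identity_nbhd G T (N n)" "\<And>V. identity_nbhd G T V \<Longrightarrow> \<exists>n::nat. N n \<subseteq> V"
    and sep: "\<And>x. x \<in> carrier G \<Longrightarrow> (\<And>V. identity_nbhd G T V \<Longrightarrow> x \<in> V) \<Longrightarrow> x = \<one>"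
    and complete: "\<And>\<sigma>. two_sided_Cauchy G T \<sigma> \<Longrightarrow> \<exists>x. limitin T \<sigma> x sequentially"
  shows "completely_metrizable_space T"
proof -
  have ex: "\<exists>W. identity_nbhd G T W \<and> W \<subseteq> V \<inter> N n \<and> (\<forall>a\<in>W. inv a \<in> W) \<and>
      (\<forall>a\<in>W. \<forall>b\<in>W. \<forall>c\<in>W. a \<otimes> b \<otimes> c \<in> V)" if V: "identity_nbhd G T V" for V n
  proof -
    obtain W where "identity_nbhd G T W" "W \<subseteq> V \<inter> N n" "\<And>a. a \<in> W \<Longrightarrow> inv a \<in> W"
        "\<And>a b c. a \<in> W \<Longrightarrow> b \<in> W \<Longrightarrow> c \<in> W \<Longrightarrow> a \<otimes> b \<otimes> c \<in> V \<inter> N n"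
      using identity_nbhd_symmetric_cube[OF identity_nbhd_Int[OF V N(1)]] by metis
    then show ?thesis
      by auto
  qed
  then obtain step where nxt: "\<And>V n. identity_nbhd G T V \<Longrightarrow> identity_nbhd G T (step V n) \<and>
      step V n \<subseteq> V \<inter> N n \<and> (\<forall>a\<in>step V n. inv a \<in> step V n) \<and>
      (\<forall>a\<in>step V n. \<forall>b\<in>step V n. \<forall>c\<in>step V n. a \<otimes> b \<otimes> c \<in> V)"
    by metis
  define K where "K = rec_nat (carrier G) (\<lambda>n V. step V n)"
  have K_simps: "K 0 = carrier G" "K (Suc n) = step (K n) n" for n
    by (simp_all add: K_def)
  have K: "identity_nbhd G T (K n)" for n
    by (induction n) (simp_all add: K_simps identity_nbhd_carrier nxt)
  have K_sym: "inv a \<in> K n" if "a \<in> K n" for a n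
    using that nxt[OF K] by (cases n) (auto simp: K_simps)
  have K_cube: "a \<otimes> b \<otimes> c \<in> K n" if "a \<in> K (Suc n)" "b \<in> K (Suc n)" "c \<in> K (Suc n)" for a b c n
    using that nxt[OF K[of n]] by (simp add: K_simps)
  have K_sub: "K (Suc n) \<subseteq> N n" for n
    using nxt[OF K[of n]] by (simp add: K_simps)
  have K_base: "\<exists>n. K n \<subseteq> V" if "identity_nbhd G T V" for V
    using N(2)[OF that] K_sub by blast
  define E where "E n x y \<longleftrightarrow> inv x \<otimes> y \<in> K n \<and> inv y \<otimes> x \<in> K n \<and> x \<otimes> inv y \<in> K n \<and> y \<otimes> inv x \<in> K n" for n x y
  have tele: "(inv x \<otimes> y) \<otimes> (inv y \<otimes> z) \<otimes> (inv z \<otimes> w) = inv x \<otimes> w"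
    "(x \<otimes> inv y) \<otimes> (y \<otimes> inv z) \<otimes> (z \<otimes> inv w) = x \<otimes> inv w"
    if "x \<in> carrier G" "y \<in> carrier G" "z \<in> carrier G" "w \<in> carrier G" for x y z w
    using that by (simp_all add: m_assoc inv_cancel_left)
  obtain d where d: "Metric_space (carrier G) d"
      "\<And>n x y. \<lbrakk>x \<in> carrier G; y \<in> carrier G; d x y < (1/2) ^ Suc n\<rbrakk> \<Longrightarrow> E n x y"
      "\<And>n x y. \<lbrakk>x \<in> carrier G; y \<in> carrier G; E n x y\<rbrakk> \<Longrightarrow> d x y < (1/2) ^ n"
  proof (rule countable_uniformity_metric[of "carrier G" E])
    show "E n x x" if "x \<in> carrier G" for n x
      using that identity_nbhdD(2)[OF K] by (simp add: E_def)
    show "E n y x" if "E n x y" for n x y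
      using that by (simp add: E_def)
    show "E n x w" if "x \<in> carrier G" "y \<in> carrier G" "z \<in> carrier G" "w \<in> carrier G"
      "E (Suc n) x y" "E (Suc n) y z" "E (Suc n) z w" for n x y z w
      using K_cube tele[OF that(1-4)] tele[OF that(4,3,2,1)] that(5-7) unfolding E_def by metis
    show "x = y" if "x \<in> carrier G" "y \<in> carrier G" "\<And>n. E n x y" for x y
    proof (rule separated_imp_eq[OF sep that(1,2)])
      show "inv x \<otimes> y \<in> V" if "identity_nbhd G T V" for V
        using K_base[OF that] \<open>\<And>n. E n x y\<close> unfolding E_def by blast
    qed
  qed blast
  interpret Metric_space "carrier G" d
    by (rule d(1))
  have small: "\<exists>n. (1/2) ^ n < (e::real)" if "0 < e" for e
    using that by (rule real_arch_pow_inv) simp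
  have "openin T U \<longleftrightarrow> openin mtopology U" for U
  proof
    assume U: "openin T U"
    show "openin mtopology U"
      unfolding openin_mtopology
    proof (intro conjI allI impI)
      show "U \<subseteq> carrier G"
        using U by (rule openin_carrier)
      fix x assume "x \<in> U"
      then obtain V where V: "identity_nbhd G T V" "\<And>y. y \<in> carrier G \<Longrightarrow> inv x \<otimes> y \<in> V \<Longrightarrow> y \<in> U"
        using U unfolding openin_iff_identity_nbhd by blast
      obtain n where "K n \<subseteq> V"
        using K_base[OF V(1)] by blast
      then have "mball x ((1/2) ^ Suc n) \<subseteq> U"
        using d(2) V(2) unfolding E_def in_mball subset_iff by blast
      then show "\<exists>r>0. mball x r \<subseteq> U"
        by (intro exI[of _ "(1/2) ^ Suc n"]) simp
    qed
  next
    assume U: "openin mtopology U"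
    show "openin T U"
      unfolding openin_iff_identity_nbhd
    proof (intro conjI ballI)
      show "U \<subseteq> carrier G"
        using U openin_mtopology by blast
      fix x assume x: "x \<in> U"
      then obtain r where r: "0 < r" "mball x r \<subseteq> U"
        using U openin_mtopology by blast
      obtain n where n: "(1/2) ^ n < r"
        using small[OF r(1)] by blast
      have xG: "x \<in> carrier G"
        using \<open>U \<subseteq> carrier G\<close> x by blast
      let ?V = "K n \<inter> {y \<in> carrier G. x \<otimes> y \<otimes> inv x \<in> K n}"
      have "y \<in> U" if "y \<in> carrier G" "inv x \<otimes> y \<in> ?V" for y
      proof -
        have e: "x \<otimes> (inv x \<otimes> y) \<otimes> inv x = y \<otimes> inv x" "inv (inv x \<otimes> y) = inv y \<otimes> x"
          "inv (y \<otimes> inv x) = x \<otimes> inv y"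
          using xG that(1) by (simp_all add: m_assoc[symmetric] inv_mult_group)
        then have "E n x y"
          using that K_sym[of "inv x \<otimes> y" n] K_sym[of "y \<otimes> inv x" n] by (simp add: E_def)
        then show "y \<in> U"
          using d(3)[OF xG that(1)] n r(2) xG that(1) by force
      qed
      moreover have "identity_nbhd G T ?V"
        using identity_nbhd_conjugate[OF K, of "inv x" n] xG by (intro identity_nbhd_Int K) simp
      ultimately show "\<exists>V. identity_nbhd G T V \<and> (\<forall>y\<in>carrier G. inv x \<otimes> y \<in> V \<longrightarrow> y \<in> U)"
        by blast
    qed
  qed
  then have top: "T = mtopology"
    by (simp add: topology_eq)
  have "mcomplete"
    unfolding mcomplete_def
  proof (intro allI impI)
    fix \<sigma> assume \<sigma>: "MCauchy \<sigma>"
    have "two_sided_Cauchy G T \<sigma>"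
      unfolding two_sided_Cauchy_def
    proof (intro conjI allI impI)
      show "range \<sigma> \<subseteq> carrier G"
        using \<sigma> unfolding MCauchy_def by blast
      fix V assume "identity_nbhd G T V"
      then obtain n where n: "K n \<subseteq> V"
        using K_base by blast
      obtain k where "\<And>i j. k \<le> i \<Longrightarrow> k \<le> j \<Longrightarrow> d (\<sigma> i) (\<sigma> j) < (1/2) ^ Suc n"
        using \<sigma> unfolding MCauchy_def by (meson half_gt_zero zero_less_one zero_less_power)
      then have "E n (\<sigma> i) (\<sigma> j)" if "k \<le> i" "k \<le> j" for i j
        using d(2) that \<open>range \<sigma> \<subseteq> carrier G\<close> by blast
      then show "\<exists>N. \<forall>m\<ge>N. \<forall>n\<ge>N. inv (\<sigma> m) \<otimes> \<sigma> n \<in> V \<and> \<sigma> m \<otimes> inv (\<sigma> n) \<in> V"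
        using n unfolding E_def by blast
    qed
    then show "\<exists>x. limitin mtopology \<sigma> x sequentially"
      using complete top by simp
  qed
  then show ?thesis
    using d(1) top unfolding completely_metrizable_space_def by blast
qed

text \<open>It suffices to find a single \<open>b\<close> for which \<open>\<sigma> n \<otimes> b\<close> converges, and Baire's theorem shows that most
  \<open>b\<close> have this property. For the complete metric \<open>d\<close>, the open sets \<open>\<D> k\<close> of points near which the
  translations by \<open>\<sigma> n\<close> eventually have oscillation below \<open>1/(k+1)\<close> are dense, and for \<open>b\<close> in all of
  them the sequence \<open>\<sigma> n \<otimes> b\<close> is Cauchy with respect to \<open>d\<close>. Density uses both halves of the Cauchy
  condition: the left half provides a point near a given one, and the right half bounds the oscillation
  there.\<close>

theorem completely_metrizable_imp_two_sided_complete: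
  assumes "completely_metrizable_space T" and \<sigma>: "two_sided_Cauchy G T \<sigma>"
  shows "\<exists>x. limitin T \<sigma> x sequentially"
proof -
  obtain M d where d: "Metric_space M d" "Metric_space.mcomplete M d" "T = Metric_space.mtopology M d"
    using assms(1) unfolding completely_metrizable_space_def by blast
  interpret Metric_space M d
    by (rule d(1))
  have M: "M = carrier G"
    using d(3) topspace_eq by simp
  note \<sigma>G = two_sided_CauchyD(1)[OF \<sigma>]
  define \<D> where "\<D> k = \<Union>{U. openin T U \<and> (\<exists>N. \<forall>m\<ge>N. \<forall>n\<ge>N. \<forall>b\<in>U. \<forall>b'\<in>U.
    d (\<sigma> m \<otimes> b) (\<sigma> n \<otimes> b') < inverse (Suc k))}" for k :: nat
  have \<D>_open: "openin T (\<D> k)" for k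
    unfolding \<D>_def by blast
  have \<D>_dense: "\<D> k \<inter> U \<noteq> {}" if U: "openin T U" "U \<noteq> {}" for k U
  proof -
    obtain b where b: "b \<in> U" "b \<in> carrier G"
      using U openin_carrier by blast
    have "identity_nbhd G T {y \<in> carrier G. y \<otimes> b \<in> U}"
      using U(1) b by (intro identity_nbhd_vimage_open continuous_map_group) simp_all
    then obtain N0 where N0: "\<And>m n. N0 \<le> m \<Longrightarrow> N0 \<le> n \<Longrightarrow> inv (\<sigma> m) \<otimes> \<sigma> n \<otimes> b \<in> U"
      using two_sided_CauchyD(2)[OF \<sigma>] by blast
    \<comment> \<open>The target \<open>c\<close> is fixed before \<open>N\<close> is chosen: the size of \<open>P\<close> depends on \<open>c\<close>, and \<open>N\<close> depends on \<open>P\<close>.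
      For large \<open>N\<close> the point \<open>inv (\<sigma> N) \<otimes> c\<close> is close to \<open>b\<close>, and \<open>\<sigma> N\<close> maps it to \<open>c\<close>.\<close>
    define c where "c = \<sigma> N0 \<otimes> b"
    have c: "c \<in> carrier G"
      using b \<sigma>G by (simp add: c_def)
    define e where "e = inverse (real (Suc k)) / 2"
    have "0 < e"
      by (simp add: e_def)
    moreover have "c \<in> M"
      using c M by simp
    ultimately have ball: "openin T (mball c e)" "c \<in> mball c e"
      by (simp_all add: d(3))
    define Y where "Y = {y \<in> carrier G. y \<otimes> c \<in> mball c e}"
    have "identity_nbhd G T Y"
      unfolding Y_def
      using ball c \<open>0 < e\<close> by (intro identity_nbhd_vimage_open continuous_map_group) simp_all
    then obtain P where P: "identity_nbhd G T P" "\<And>x y. x \<in> P \<Longrightarrow> y \<in> P \<Longrightarrow> x \<otimes> y \<in> Y"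
      using identity_nbhd_symmetric_square by metis
    have "identity_nbhd G T {w \<in> carrier G. inv (inv c) \<otimes> w \<otimes> inv c \<in> P}"
      using c by (intro identity_nbhd_conjugate P(1)) simp
    then obtain Q where Q: "openin T Q" "\<one> \<in> Q" "\<And>w. w \<in> Q \<Longrightarrow> w \<in> carrier G \<and> c \<otimes> w \<otimes> inv c \<in> P"
      using c unfolding identity_nbhd_def by auto
    obtain N1 where N1: "\<And>m n. N1 \<le> m \<Longrightarrow> N1 \<le> n \<Longrightarrow> \<sigma> m \<otimes> inv (\<sigma> n) \<in> P"
      using two_sided_CauchyD(3)[OF \<sigma> P(1)] by blast
    define N where "N = max N0 N1"
    define O' where "O' = {x \<in> carrier G. inv c \<otimes> \<sigma> N \<otimes> x \<in> Q}"
    have "openin T O'"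
      unfolding O'_def using Q(1) c \<sigma>G by (intro openin_left_translate) simp_all
    moreover have near: "\<sigma> n \<otimes> x \<in> mball c e" if n: "N \<le> n" and x: "x \<in> O'" for n x
    proof -
      have xG: "x \<in> carrier G" and q: "inv c \<otimes> \<sigma> N \<otimes> x \<in> Q"
        using x by (simp_all add: O'_def)
      have "(\<sigma> n \<otimes> inv (\<sigma> N)) \<otimes> (c \<otimes> (inv c \<otimes> \<sigma> N \<otimes> x) \<otimes> inv c) \<otimes> c = \<sigma> n \<otimes> x"
        using c \<sigma>G xG by (simp add: m_assoc inv_cancel_left)
      moreover have "\<sigma> n \<otimes> inv (\<sigma> N) \<in> P"
        using n by (intro N1) (simp_all add: N_def)
      ultimately show ?thesis
        using P(2)[of "\<sigma> n \<otimes> inv (\<sigma> N)" "c \<otimes> (inv c \<otimes> \<sigma> N \<otimes> x) \<otimes> inv c"] Q(3)[OF q] by (simp add: Y_def)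
    qed
    have "d (\<sigma> m \<otimes> x) (\<sigma> n \<otimes> y) < inverse (Suc k)" if "N \<le> m" "N \<le> n" "x \<in> O'" "y \<in> O'" for m n x y
    proof -
      have "d (\<sigma> m \<otimes> x) c < e" "d c (\<sigma> n \<otimes> y) < e" "\<sigma> m \<otimes> x \<in> M" "\<sigma> n \<otimes> y \<in> M"
        using near[OF that(1,3)] near[OF that(2,4)] by (simp_all add: commute)
      then show ?thesis
        using triangle[of "\<sigma> m \<otimes> x" c "\<sigma> n \<otimes> y"] c M by (simp add: e_def)
    qed
    ultimately have "O' \<subseteq> \<D> k"
      unfolding \<D>_def by blast
    moreover have "inv (\<sigma> N) \<otimes> c \<in> O'"
    proof -
      have "inv c \<otimes> \<sigma> N \<otimes> (inv (\<sigma> N) \<otimes> c) = \<one>"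
        using c \<sigma>G by (metis inv_closed inv_mult_group inv_inv l_inv m_closed)
      then show ?thesis
        using c \<sigma>G Q(2) by (simp add: O'_def)
    qed
    moreover have "inv (\<sigma> N) \<otimes> c \<in> U"
      using N0[of N N0] b \<sigma>G by (simp add: c_def N_def m_assoc)
    ultimately show ?thesis
      by blast
  qed
  have "mtopology closure_of (\<Inter>(range \<D>)) = M"
  proof (rule metric_Baire_category[OF d(2)])
    fix U assume "U \<in> range \<D>"
    then show "openin mtopology U \<and> mtopology closure_of U = M"
      using \<D>_open \<D>_dense dense_intersects_open[of mtopology] d(3) by auto
  qed simp
  then have "\<Inter>(range \<D>) \<noteq> {}"
    using M one_closed by force
  then obtain b where b: "\<And>k. b \<in> \<D> k"
    by auto
  have bG: "b \<in> carrier G"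
    using b[of 0] \<D>_open[of 0] openin_carrier by blast
  have "MCauchy (\<lambda>n. \<sigma> n \<otimes> b)"
    unfolding MCauchy_def
  proof (intro conjI allI impI)
    show "range (\<lambda>n. \<sigma> n \<otimes> b) \<subseteq> M"
      using M \<sigma>G bG by auto
    fix e :: real assume "0 < e"
    then obtain k where k: "inverse (real (Suc k)) < e"
      using reals_Archimedean by blast
    obtain N where "\<And>m n. N \<le> m \<Longrightarrow> N \<le> n \<Longrightarrow> d (\<sigma> m \<otimes> b) (\<sigma> n \<otimes> b) < inverse (Suc k)"
      using b[of k] unfolding \<D>_def by blast
    then show "\<exists>N. \<forall>n n'. N \<le> n \<longrightarrow> N \<le> n' \<longrightarrow> d (\<sigma> n \<otimes> b) (\<sigma> n' \<otimes> b) < e"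
      using k by (meson less_trans)
  qed
  then obtain a where "limitin T (\<lambda>n. \<sigma> n \<otimes> b) a sequentially"
    using d(2,3) unfolding mcomplete_def by blast
  then have "limitin T (\<lambda>n. \<sigma> n \<otimes> b \<otimes> inv b) (a \<otimes> inv b) sequentially"
    using bG by (intro limitin_mult) simp_all
  then show ?thesis
    using bG \<sigma>G by (auto simp: m_assoc)
qed

section \<open>Roelcke-precompact sets\<close>

lemma lower_entourage_iff:
  assumes "V \<subseteq> carrier G"
  shows "(x, y) \<in> lower_entourage G V \<longleftrightarrow> y \<in> carrier G \<and> (\<exists>a\<in>V. \<exists>b\<in>V. x = a \<otimes> y \<otimes> b)"
  using assms unfolding lower_entourage_def set_mult_def by fastforce

lemma lower_entourage_sym:
  assumes V: "V \<subseteq> carrier G" "\<And>a. a \<in> V \<Longrightarrow> inv a \<in> V"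
    and xy: "(x, y) \<in> lower_entourage G V"
  shows "(y, x) \<in> lower_entourage G V"
proof -
  obtain a b where ab: "a \<in> V" "b \<in> V" "x = a \<otimes> y \<otimes> b" and y: "y \<in> carrier G"
    using xy unfolding lower_entourage_iff[OF V(1)] by blast
  have abG: "a \<in> carrier G" "b \<in> carrier G"
    using ab V by auto
  then have "y = inv a \<otimes> x \<otimes> inv b"
    unfolding ab(3) using y by (simp add: m_assoc inv_cancel_left)
  then show ?thesis
    using V(2)[OF ab(1)] V(2)[OF ab(2)] abG y unfolding lower_entourage_iff[OF V(1)]
    by (metis (no_types) ab(3) m_closed)
qed

lemma lower_entourage_trans':
  assumes "W \<subseteq> carrier G" "\<And>a b. a \<in> W \<Longrightarrow> b \<in> W \<Longrightarrow> a \<otimes> b \<in> V"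
    and "(x, y) \<in> lower_entourage G W" "(y, z) \<in> lower_entourage G W"
  shows "(x, z) \<in> lower_entourage G V"
  by (rule lower_entourage_trans[OF assms(1) _ assms(3,4)]) (use assms(2) in \<open>auto simp: set_mult_def\<close>)

lemma lower_entourage_hom:
  assumes f: "f \<in> hom G G" and V: "V \<subseteq> carrier G" "W \<subseteq> carrier G" "\<And>v. v \<in> V \<Longrightarrow> f v \<in> W"
    and xy: "(x, y) \<in> lower_entourage G V"
  shows "(f x, f y) \<in> lower_entourage G W"
proof -
  obtain a b where "a \<in> V" "b \<in> V" "x = a \<otimes> y \<otimes> b" "y \<in> carrier G"
    using xy unfolding lower_entourage_iff[OF V(1)] by blast
  then have "f x = f a \<otimes> f y \<otimes> f b" "f y \<in> carrier G" "f a \<in> W" "f b \<in> W"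
    using f V by (auto simp: hom_mult subset_iff hom_in_carrier)
  then show ?thesis
    unfolding lower_entourage_iff[OF V(2)] by blast
qed

text \<open>The lower uniform structure induces the topology of the group: if \<open>y = a \<otimes> x \<otimes> b\<close>, then
  \<open>inv x \<otimes> y\<close> is \<open>b\<close> multiplied by a conjugate of \<open>a\<close> by the fixed element \<open>x\<close>.\<close>

lemma lower_entourage_topology:
  assumes V: "identity_nbhd G T V" and x: "x \<in> carrier G"
  obtains W where "identity_nbhd G T W"
    "\<And>y. (y, x) \<in> lower_entourage G W \<Longrightarrow> inv x \<otimes> y \<in> V \<and> y \<otimes> inv x \<in> V"
proof -
  obtain P where P: "identity_nbhd G T P" "P \<subseteq> V" "\<And>a b. a \<in> P \<Longrightarrow> b \<in> P \<Longrightarrow> a \<otimes> b \<in> V"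
    using identity_nbhd_symmetric_square[OF V] by metis
  let ?W = "P \<inter> ({y \<in> carrier G. inv x \<otimes> y \<otimes> x \<in> P} \<inter> {y \<in> carrier G. x \<otimes> y \<otimes> inv x \<in> P})"
  have W: "identity_nbhd G T ?W"
    using identity_nbhd_conjugate[OF P(1), of x] identity_nbhd_conjugate[OF P(1), of "inv x"] x
    by (intro identity_nbhd_Int P(1)) simp_all
  have "inv x \<otimes> y \<in> V \<and> y \<otimes> inv x \<in> V" if y: "(y, x) \<in> lower_entourage G ?W" for y
  proof -
    obtain a b where ab: "a \<in> ?W" "b \<in> ?W" "y = a \<otimes> x \<otimes> b"
      using y unfolding lower_entourage_iff[OF identity_nbhdD(1)[OF W]] by blast
    then have "inv x \<otimes> y = (inv x \<otimes> a \<otimes> x) \<otimes> b" "y \<otimes> inv x = a \<otimes> (x \<otimes> b \<otimes> inv x)"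
      using x by (simp_all add: m_assoc)
    then show ?thesis
      using ab P(3) by simp
  qed
  with W show thesis
    by (rule that)
qed

lemma roelcke_precompact_iff:
  "roelcke_precompact G T A \<longleftrightarrow> A \<subseteq> carrier G \<and> (\<forall>V. identity_nbhd G T V \<longrightarrow>
    (\<exists>F. finite F \<and> F \<subseteq> carrier G \<and> (\<forall>a\<in>A. \<exists>f\<in>F. (a, f) \<in> lower_entourage G V)))"
proof -
  have "A \<subseteq> V <#> F <#> V \<longleftrightarrow> (\<forall>a\<in>A. \<exists>f\<in>F. (a, f) \<in> lower_entourage G V)"
    if "identity_nbhd G T V" "F \<subseteq> carrier G" for V F
    using that unfolding lower_entourage_iff[OF identity_nbhdD(1)[OF that(1)]] set_mult_def subset_iff
    by (auto; blast)
  then show ?thesis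
    unfolding roelcke_precompact_def by (metis (no_types, lifting))
qed

lemma roelcke_precompactD:
  assumes "roelcke_precompact G T A"
  shows "A \<subseteq> carrier G"
    and "identity_nbhd G T V \<Longrightarrow> \<exists>F. finite F \<and> F \<subseteq> carrier G \<and>
      (\<forall>a\<in>A. \<exists>f\<in>F. (a, f) \<in> lower_entourage G V)"
  using assms unfolding roelcke_precompact_iff by blast+

lemma roelcke_precompact_subset:
  "roelcke_precompact G T A \<Longrightarrow> B \<subseteq> A \<Longrightarrow> roelcke_precompact G T B"
  unfolding roelcke_precompact_iff by (meson subset_iff subset_trans)

lemma roelcke_precompact_Un:
  assumes "roelcke_precompact G T A" "roelcke_precompact G T B"
  shows "roelcke_precompact G T (A \<union> B)"
  unfolding roelcke_precompact_iff
proof (intro conjI allI impI)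
  show "A \<union> B \<subseteq> carrier G"
    using assms[THEN roelcke_precompactD(1)] by simp
  fix V assume V: "identity_nbhd G T V"
  obtain F F' where "finite F" "F \<subseteq> carrier G" "\<forall>a\<in>A. \<exists>f\<in>F. (a, f) \<in> lower_entourage G V"
    "finite F'" "F' \<subseteq> carrier G" "\<forall>a\<in>B. \<exists>f\<in>F'. (a, f) \<in> lower_entourage G V"
    using assms[THEN roelcke_precompactD(2), OF V] by metis
  then show "\<exists>F. finite F \<and> F \<subseteq> carrier G \<and> (\<forall>a\<in>A\<union>B. \<exists>f\<in>F. (a, f) \<in> lower_entourage G V)"
    by (intro exI[of _ "F \<union> F'"]) auto
qed

lemma roelcke_precompact_UN:
  "finite I \<Longrightarrow> (\<And>i. i \<in> I \<Longrightarrow> roelcke_precompact G T (A i)) \<Longrightarrow> roelcke_precompact G T (\<Union>i\<in>I. A i)"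
proof (induction I rule: finite_induct)
  case empty
  then show ?case
    unfolding roelcke_precompact_iff by auto
qed (simp add: roelcke_precompact_Un)

lemma roelcke_precompact_translate:
  assumes A: "roelcke_precompact G T A" and cd: "c \<in> carrier G" "d \<in> carrier G"
  shows "roelcke_precompact G T ((\<lambda>a. c \<otimes> a \<otimes> d) ` A)"
  unfolding roelcke_precompact_iff
proof (intro conjI allI impI)
  show "(\<lambda>a. c \<otimes> a \<otimes> d) ` A \<subseteq> carrier G"
    using roelcke_precompactD(1)[OF A] cd by auto
  fix V assume V: "identity_nbhd G T V"
  let ?W = "{y \<in> carrier G. c \<otimes> y \<otimes> inv c \<in> V} \<inter> {y \<in> carrier G. inv d \<otimes> y \<otimes> d \<in> V}"
  have W: "identity_nbhd G T ?W"
    using identity_nbhd_conjugate[OF V, of "inv c"] identity_nbhd_conjugate[OF V, of d] cd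
    by (intro identity_nbhd_Int) simp_all
  obtain F where F: "finite F" "F \<subseteq> carrier G" "\<And>a. a \<in> A \<Longrightarrow> \<exists>f\<in>F. (a, f) \<in> lower_entourage G ?W"
    using roelcke_precompactD(2)[OF A W] by blast
  have "(c \<otimes> a \<otimes> d, c \<otimes> f \<otimes> d) \<in> lower_entourage G V" if af: "(a, f) \<in> lower_entourage G ?W" for a f
  proof -
    obtain x y where xy: "x \<in> ?W" "y \<in> ?W" "a = x \<otimes> f \<otimes> y" "f \<in> carrier G"
      using af unfolding lower_entourage_iff[OF identity_nbhdD(1)[OF W]] by blast
    have "c \<otimes> a \<otimes> d = (c \<otimes> x \<otimes> inv c) \<otimes> (c \<otimes> f \<otimes> d) \<otimes> (inv d \<otimes> y \<otimes> d)"
      using xy cd by (simp add: m_assoc inv_cancel_left)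
    then show ?thesis
      using xy cd unfolding lower_entourage_iff[OF identity_nbhdD(1)[OF V]] by auto
  qed
  then show "\<exists>F. finite F \<and> F \<subseteq> carrier G \<and>
      (\<forall>a\<in>(\<lambda>a. c \<otimes> a \<otimes> d) ` A. \<exists>f\<in>F. (a, f) \<in> lower_entourage G V)"
    using F cd by (intro exI[of _ "(\<lambda>f. c \<otimes> f \<otimes> d) ` F"]) (fastforce simp: image_subset_iff)
qed

text \<open>If \<open>W <#> W \<subseteq> U\<close> and \<open>A \<subseteq> W F W\<close>, \<open>B \<subseteq> W F' W\<close> with finite \<open>F\<close> and \<open>F'\<close>, then the product of \<open>A\<close> and \<open>B\<close> is
  contained in \<open>W (F U F') W\<close>. The middle factor is a finite union of translates of \<open>U\<close>, hence again
  Roelcke-precompact and contained in \<open>W H W\<close> with a finite \<open>H\<close>.\<close>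

lemma roelcke_precompact_mult:
  assumes U: "identity_nbhd G T U" "roelcke_precompact G T U"
    and AB: "roelcke_precompact G T A" "roelcke_precompact G T B"
  shows "roelcke_precompact G T (A <#> B)"
  unfolding roelcke_precompact_iff
proof (intro conjI allI impI)
  show "A <#> B \<subseteq> carrier G"
    using AB[THEN roelcke_precompactD(1)] by (rule set_mult_closed)
  fix V assume V: "identity_nbhd G T V"
  obtain W where W: "identity_nbhd G T W" "W \<subseteq> V" "\<And>a b. a \<in> W \<Longrightarrow> b \<in> W \<Longrightarrow> a \<otimes> b \<in> U \<inter> V"
    using identity_nbhd_symmetric_square[OF identity_nbhd_Int[OF U(1) V]] by (metis le_inf_iff)
  have WG: "W \<subseteq> carrier G"
    using identity_nbhdD(1)[OF W(1)] .
  obtain F F' where F: "finite F" "F \<subseteq> carrier G" "\<And>a. a \<in> A \<Longrightarrow> \<exists>f\<in>F. (a, f) \<in> lower_entourage G W"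
    and F': "finite F'" "F' \<subseteq> carrier G" "\<And>b. b \<in> B \<Longrightarrow> \<exists>f\<in>F'. (b, f) \<in> lower_entourage G W"
    using AB[THEN roelcke_precompactD(2), OF W(1)] by metis
  let ?C = "\<Union>p\<in>F \<times> F'. (\<lambda>u. fst p \<otimes> u \<otimes> snd p) ` U"
  have "roelcke_precompact G T ?C"
    using F F' U(2) by (intro roelcke_precompact_UN roelcke_precompact_translate) auto
  from roelcke_precompactD(2)[OF this W(1)]
  obtain H where H': "finite H \<and> H \<subseteq> carrier G \<and> (\<forall>z\<in>?C. \<exists>h\<in>H. (z, h) \<in> lower_entourage G W)" ..
  note H = conjunct1[OF H'] conjunct1[OF conjunct2[OF H']] conjunct2[OF conjunct2[OF H']]
  have "\<exists>h\<in>H. (z, h) \<in> lower_entourage G V" if "z \<in> A <#> B" for z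
  proof -
    obtain x y where xy: "x \<in> A" "y \<in> B" "z = x \<otimes> y"
      using \<open>z \<in> A <#> B\<close> unfolding set_mult_def by blast
    obtain f a b where f: "f \<in> F" "f \<in> carrier G" "a \<in> W" "b \<in> W" "x = a \<otimes> f \<otimes> b"
      using F(3)[OF xy(1)] unfolding lower_entourage_iff[OF WG] by blast
    obtain f' a' b' where f': "f' \<in> F'" "f' \<in> carrier G" "a' \<in> W" "b' \<in> W" "y = a' \<otimes> f' \<otimes> b'"
      using F'(3)[OF xy(2)] unfolding lower_entourage_iff[OF WG] by blast
    have inG: "a \<in> carrier G" "b \<in> carrier G" "a' \<in> carrier G" "b' \<in> carrier G"
      using f f' WG by auto
    have "z = a \<otimes> (f \<otimes> (b \<otimes> a') \<otimes> f') \<otimes> b'"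
      unfolding xy(3) f(5) f'(5) using f f' inG by (simp add: m_assoc)
    then have 1: "(z, f \<otimes> (b \<otimes> a') \<otimes> f') \<in> lower_entourage G W"
      using f f' inG unfolding lower_entourage_iff[OF WG] by blast
    obtain h where h: "h \<in> H" "(f \<otimes> (b \<otimes> a') \<otimes> f', h) \<in> lower_entourage G W"
    proof -
      have "f \<otimes> (b \<otimes> a') \<otimes> f' \<in> ?C"
        using f(1) f'(1) W(3)[OF f(4) f'(3)] by force
      then have "\<exists>h\<in>H. (f \<otimes> (b \<otimes> a') \<otimes> f', h) \<in> lower_entourage G W"
        using H(3) by (rule bspec[rotated])
      then show thesis
        using that by blast
    qed
    show ?thesis
      using lower_entourage_trans'[OF WG _ 1 h(2), of V] W(3) h(1) by blast
  qed
  then show "\<exists>F. finite F \<and> F \<subseteq> carrier G \<and> (\<forall>a\<in>A <#> B. \<exists>f\<in>F. (a, f) \<in> lower_entourage G V)"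
    using H by blast
qed

text \<open>A member \<open>V k\<close> of the exhaustion that contains \<open>\<one>\<close> is an identity neighborhood, so \<open>A \<subseteq> V k F V k\<close>. The
  finite set \<open>F\<close> lies in some \<open>V l\<close> with \<open>k \<le> l\<close>, and two squaring steps absorb the product.\<close>

lemma roelcke_precompact_imp_group_bounded:
  assumes A: "roelcke_precompact G T A"
  shows "group_bounded G T A"
  unfolding group_bounded_def
proof (intro conjI allI impI)
  show "A \<subseteq> carrier G"
    using roelcke_precompactD(1)[OF A] .
  fix V :: "nat \<Rightarrow> 'a set"
  assume "(\<forall>n. openin T (V n)) \<and> (\<forall>n. V n \<subseteq> V (Suc n)) \<and> \<Union> (range V) = carrier G \<and>
    (\<forall>n. V n <#> V n \<subseteq> V (Suc n))"
  then have V: "\<And>n. openin T (V n)" "\<And>n. V n \<subseteq> V (Suc n)" "\<Union> (range V) = carrier G"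
    "\<And>n a b. a \<in> V n \<Longrightarrow> b \<in> V n \<Longrightarrow> a \<otimes> b \<in> V (Suc n)"
    unfolding set_mult_def by blast+
  have mono: "V m \<subseteq> V n" if "m \<le> n" for m n
    using lift_Suc_mono_le[of V, OF V(2) that] .
  obtain k where k: "\<one> \<in> V k"
    using V(3) one_closed by blast
  obtain F where F: "finite F" "F \<subseteq> carrier G" "\<And>a. a \<in> A \<Longrightarrow> \<exists>f\<in>F. (a, f) \<in> lower_entourage G (V k)"
    using roelcke_precompactD(2)[OF A openin_imp_identity_nbhd[OF V(1) k]] by blast
  have "\<exists>n. f \<in> V n" if "f \<in> F" for f
    using that F(2) V(3) by blast
  then obtain n where n: "\<And>f. f \<in> F \<Longrightarrow> f \<in> V (n f)"
    by metis
  define l where "l = Max (insert k (n ` F))"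
  have "k \<le> l" and F_l: "F \<subseteq> V l"
  proof -
    show "k \<le> l"
      using F(1) by (simp add: l_def)
    have "n f \<le> l" if "f \<in> F" for f
      using F(1) that by (simp add: l_def)
    then show "F \<subseteq> V l"
      using n mono by blast
  qed
  have "A \<subseteq> V (Suc (Suc l))"
  proof
    fix x assume "x \<in> A"
    then obtain f a b where f: "f \<in> F" "a \<in> V k" "b \<in> V k" "x = a \<otimes> f \<otimes> b"
      using F(3)[of x] unfolding lower_entourage_iff[OF openin_carrier[OF V(1)]] by blast
    then have "a \<otimes> f \<in> V (Suc l)" "b \<in> V (Suc l)"
      using V(4) F_l mono[OF \<open>k \<le> l\<close>] V(2)[of l] by blast+
    then show "x \<in> V (Suc (Suc l))"
      using V(4) f(4) by simp
  qed
  then show "\<exists>k. A \<subseteq> V k"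
    by blast
qed

lemma openin_set_mult_right:
  assumes "A \<subseteq> carrier G" "openin T U"
  shows "openin T (A <#> U)"
proof -
  have "A <#> U = (\<Union>a\<in>A. {y \<in> carrier G. inv a \<otimes> y \<in> U})"
  proof (intro equalityI subsetI)
    fix y assume "y \<in> A <#> U"
    then obtain a u where "a \<in> A" "u \<in> U" "y = a \<otimes> u"
      unfolding set_mult_def by blast
    moreover from this have "inv a \<otimes> y = u" "y \<in> carrier G"
      using assms openin_carrier[OF assms(2)] by (auto simp: inv_cancel_left subset_iff)
    ultimately show "y \<in> (\<Union>a\<in>A. {y \<in> carrier G. inv a \<otimes> y \<in> U})"
      by (intro UN_I[of a]) simp_all
  next
    fix y assume "y \<in> (\<Union>a\<in>A. {y \<in> carrier G. inv a \<otimes> y \<in> U})"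
    then obtain a where a: "a \<in> A" "y \<in> carrier G" "inv a \<otimes> y \<in> U"
      by blast
    then have "y = a \<otimes> (inv a \<otimes> y)"
      using assms by (simp add: m_assoc[symmetric] subset_iff)
    then show "y \<in> A <#> U"
      using a unfolding set_mult_def by blast
  qed
  moreover have "openin T {y \<in> carrier G. inv a \<otimes> y \<in> U}" if "a \<in> A" for a
    using that assms by (intro openin_left_translate) auto
  ultimately show ?thesis
    by auto
qed

text \<open>The sets \<open>P n\<close> are built as an exhaustion of the kind that occurs in the definition of boundedness, so
  that every bounded set lies in one of them. Translates of an open Roelcke-precompact set by a
  dense sequence make them cover the group.\<close>

theorem roelcke_precompact_exhaustion:
  assumes "separable_space T" and U: "identity_nbhd G T U" "roelcke_precompact G T U"
  obtains P :: "nat \<Rightarrow> 'a set" where "\<And>n. roelcke_precompact G T (P n)"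
    "\<And>B. group_bounded G T B \<Longrightarrow> \<exists>n. B \<subseteq> P n"
proof -
  obtain O' where O': "openin T O'" "\<one> \<in> O'" "O' \<subseteq> U"
    using U(1) unfolding identity_nbhd_def by blast
  have O'_rp: "roelcke_precompact G T O'"
    using U(2) O'(3) by (rule roelcke_precompact_subset)
  have O'_G: "O' \<subseteq> carrier G"
    using openin_carrier[OF O'(1)] .
  obtain C where C: "countable C" "C \<subseteq> carrier G"
    and C_hits: "\<forall>S. openin T S \<and> S \<noteq> {} \<longrightarrow> C \<inter> S \<noteq> {}"
    using assms(1)[unfolded separable_space_def dense_intersects_open, unfolded topspace_eq]
    by (elim exE conjE)
  then have "C \<noteq> {}"
    using openin_topspace topspace_eq by fastforce
  define c where "c = from_nat_into C"
  have c: "range c = C" "\<And>n. c n \<in> carrier G"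
    using range_from_nat_into[OF \<open>C \<noteq> {}\<close> C(1)] from_nat_into[OF \<open>C \<noteq> {}\<close>] C(2) by (auto simp: c_def)
  define P where "P = rec_nat O' (\<lambda>n Q. Q \<union> (Q <#> Q) \<union> ({c n} <#> O'))"
  have P_simps: "P 0 = O'" "P (Suc n) = P n \<union> (P n <#> P n) \<union> ({c n} <#> O')" for n
    by (simp_all add: P_def)
  have rp: "roelcke_precompact G T (P n)" for n
  proof (induction n)
    case (Suc n)
    have "roelcke_precompact G T ({c n} <#> O')"
    proof -
      have "(\<lambda>a. c n \<otimes> a \<otimes> \<one>) ` O' = {c n} <#> O'"
        using c(2)[of n] O'_G unfolding set_mult_def by (auto simp: image_iff subset_iff)
      then show ?thesis
        using roelcke_precompact_translate[OF O'_rp c(2)[of n] one_closed] by simp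
    qed
    then show ?case
      unfolding P_simps using roelcke_precompact_mult[OF U Suc Suc] Suc
      by (intro roelcke_precompact_Un)
  qed (simp add: P_simps O'_rp)
  have P_open: "openin T (P n)" for n
  proof (induction n)
    case (Suc n)
    then show ?case
      unfolding P_simps using c(2) O'(1) openin_carrier[OF Suc]
      by (intro openin_Un openin_set_mult_right) auto
  qed (simp add: P_simps O')
  have "carrier G \<subseteq> \<Union>(range P)"
  proof
    fix y assume y: "y \<in> carrier G"
    \<comment> \<open>The translate \<open>{c n} <#> O'\<close> contains \<open>y\<close> as soon as \<open>c n\<close> lies in this neighborhood of \<open>y\<close>.\<close>
    let ?S = "{x \<in> carrier G. inv x \<otimes> y \<in> O'}"
    have "continuous_map T T (\<lambda>x. inv x \<otimes> y)"
      using y by (intro continuous_map_group)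
    then have "openin T ?S"
      using openin_continuous_map_preimage[OF _ O'(1), of T "\<lambda>x. inv x \<otimes> y"] by simp
    moreover have "y \<in> ?S"
      using y O' by simp
    ultimately obtain n where n: "c n \<in> ?S"
      using C_hits c(1) by blast
    then have "y = c n \<otimes> (inv (c n) \<otimes> y)"
      using c(2) y by (simp add: m_assoc[symmetric])
    then have "y \<in> P (Suc n)"
      using n unfolding P_simps set_mult_def by blast
    then show "y \<in> \<Union>(range P)"
      by blast
  qed
  moreover have "P n \<subseteq> carrier G" for n
    using rp roelcke_precompactD(1) by blast
  ultimately have P_Un: "\<Union>(range P) = carrier G"
    by blast
  have P_mult: "P n \<subseteq> P (Suc n)" "P n <#> P n \<subseteq> P (Suc n)" for n
    unfolding P_simps by blast+
  show thesis
  proof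
    show "roelcke_precompact G T (P n)" for n
      by (rule rp)
    show "\<exists>n. B \<subseteq> P n" if "group_bounded G T B" for B
      using that P_open P_Un P_mult unfolding group_bounded_def by blast
  qed
qed

section \<open>The automorphism group\<close>

lemma Aut_iff:
  "f \<in> carrier (Aut G T) \<longleftrightarrow> f \<in> extensional (carrier G) \<and> f \<in> hom G G \<and> (\<exists>g. homeomorphic_maps T T f g)"
proof -
  have "bij_betw f (carrier G) (carrier G)" if "homeomorphic_maps T T f g" for g
    using homeomorphic_imp_injective_map homeomorphic_imp_surjective_map that topspace_eq
    unfolding homeomorphic_maps_map bij_betw_def by metis
  then show ?thesis
    by (auto simp: Aut_def auto_def Bij_def homeomorphic_map_maps)
qed

lemma subgroup_Aut: "subgroup (carrier (Aut G T)) (BijGroup (carrier G))"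
proof
  let ?A = "carrier (Aut G T)"
  show sub: "?A \<subseteq> carrier (BijGroup (carrier G))"
    by (auto simp: Aut_def auto_def BijGroup_def)
  show "f \<otimes>\<^bsub>BijGroup (carrier G)\<^esub> g \<in> ?A" if f: "f \<in> ?A" and g: "g \<in> ?A" for f g
  proof -
    have comp: "f \<otimes>\<^bsub>BijGroup (carrier G)\<^esub> g = compose (carrier G) f g"
      using sub f g by (auto simp: BijGroup_def)
    obtain f' g' where "homeomorphic_maps T T f f'" "homeomorphic_maps T T g g'"
      using f g unfolding Aut_iff by blast
    then have "homeomorphic_maps T T (f \<circ> g) (g' \<circ> f')"
      using homeomorphic_maps_compose by metis
    then have "homeomorphic_maps T T (compose (carrier G) f g) (g' \<circ> f')"
      by (rule homeomorphic_maps_eq) (simp_all add: compose_def)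
    then show ?thesis
      unfolding comp Aut_iff using f g hom_compose by (auto simp: Aut_iff)
  qed
  show "\<one>\<^bsub>BijGroup (carrier G)\<^esub> \<in> ?A"
  proof -
    have "homeomorphic_maps T T (\<lambda>x\<in>carrier G. x) (\<lambda>x. x)"
      by (rule homeomorphic_maps_eq[of _ _ "\<lambda>x. x" "\<lambda>x. x"]) (simp_all add: homeomorphic_maps_def)
    then show ?thesis
      unfolding Aut_iff using id_in_auto by (auto simp: BijGroup_def auto_def)
  qed
  show "inv\<^bsub>BijGroup (carrier G)\<^esub> f \<in> ?A" if f: "f \<in> ?A" for f
  proof -
    have fB: "f \<in> Bij (carrier G)" "f \<in> hom G G"
      using f by (auto simp: Aut_def auto_def)
    obtain g where g: "homeomorphic_maps T T f g"
      using f unfolding Aut_iff by blast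
    have bij: "bij_betw f (carrier G) (carrier G)"
      using fB by (simp add: Bij_def)
    have "homeomorphic_maps T T g f"
      using g homeomorphic_maps_sym by blast
    moreover have "g x = restrict (inv_into (carrier G) f) (carrier G) x" if "x \<in> carrier G" for x
    proof -
      have "g x \<in> carrier G" "f (g x) = x"
        using g that unfolding homeomorphic_maps_def continuous_map_def by auto
      then have "inv_into (carrier G) f x = g x"
        using bij by (intro inv_into_f_eq) (simp_all add: bij_betw_def)
      then show ?thesis
        using that by simp
    qed
    ultimately have "homeomorphic_maps T T (restrict (inv_into (carrier G) f) (carrier G)) f"
      by (rule homeomorphic_maps_eq) simp_all
    then show ?thesis
      unfolding Aut_iff inv_BijGroup[OF fB(1)] using restrict_inv_into_hom[OF fB(2,1)] by auto
  qed
qed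

lemma Aut_eq: "Aut G T = (BijGroup (carrier G))\<lparr>carrier := carrier (Aut G T)\<rparr>"
  by (simp add: Aut_def AutoGroup_def)

lemma group_Aut: "group (Aut G T)"
  using subgroup.subgroup_is_group[OF subgroup_Aut group_BijGroup] Aut_eq by simp

lemma Aut_in_Bij: "f \<in> carrier (Aut G T) \<Longrightarrow> f \<in> Bij (carrier G)"
  by (simp add: Aut_def auto_def)

lemma Aut_one_apply: "x \<in> carrier G \<Longrightarrow> \<one>\<^bsub>Aut G T\<^esub> x = x"
  by (subst Aut_eq) (simp add: BijGroup_def)

lemma Aut_mult_apply:
  assumes "f \<in> carrier (Aut G T)" "g \<in> carrier (Aut G T)" "x \<in> carrier G"
  shows "(f \<otimes>\<^bsub>Aut G T\<^esub> g) x = f (g x)"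
  using assms by (subst Aut_eq) (simp add: BijGroup_def Aut_in_Bij compose_def)

lemma Aut_inv_eq:
  assumes "f \<in> carrier (Aut G T)"
  shows "inv\<^bsub>Aut G T\<^esub> f = restrict (inv_into (carrier G) f) (carrier G)"
proof -
  have "inv\<^bsub>(BijGroup (carrier G))\<lparr>carrier := carrier (Aut G T)\<rparr>\<^esub> f = inv\<^bsub>BijGroup (carrier G)\<^esub> f"
    using group.m_inv_consistent[OF group_BijGroup subgroup_Aut assms] .
  then show ?thesis
    unfolding Aut_eq[symmetric] inv_BijGroup[OF Aut_in_Bij[OF assms]] .
qed

lemma Aut_inv_closed: "f \<in> carrier (Aut G T) \<Longrightarrow> inv\<^bsub>Aut G T\<^esub> f \<in> carrier (Aut G T)"
  by (rule group.inv_closed[OF group_Aut])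

lemma Aut_inv_apply:
  assumes "f \<in> carrier (Aut G T)" "x \<in> carrier G"
  shows "f ((inv\<^bsub>Aut G T\<^esub> f) x) = x" "(inv\<^bsub>Aut G T\<^esub> f) (f x) = x"
proof -
  have "f x \<in> carrier G"
    using Aut_apply_closed(1)[OF assms] .
  then show "f ((inv\<^bsub>Aut G T\<^esub> f) x) = x" "(inv\<^bsub>Aut G T\<^esub> f) (f x) = x"
    using Aut_in_Bij[OF assms(1)] assms(2) unfolding Aut_inv_eq[OF assms(1)] Bij_def
    by (auto simp: bij_betw_def f_inv_into_f)
qed

lemma Aut_hom: "f \<in> carrier (Aut G T) \<Longrightarrow> f \<in> hom G G"
  unfolding Aut_iff by blast

lemma Aut_continuous: "f \<in> carrier (Aut G T) \<Longrightarrow> continuous_map T T f"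
  unfolding Aut_iff homeomorphic_maps_def by blast

lemma Aut_identity_nbhd:
  assumes "f \<in> carrier (Aut G T)" "identity_nbhd G T V"
  shows "identity_nbhd G T {x \<in> carrier G. f x \<in> V}"
  using assms group_hom.hom_one[OF hom_group_hom[OF Aut_hom[OF assms(1)]]]
  by (intro identity_nbhd_vimage Aut_continuous)

lemma lower_nbhd_iff:
  assumes "g \<in> carrier (Aut G T)" "B \<subseteq> carrier G"
  shows "h \<in> lower_nbhd G T B V g \<longleftrightarrow> h \<in> carrier (Aut G T) \<and> (\<forall>x\<in>B.
    (h x, g x) \<in> lower_entourage G V \<and>
    ((inv\<^bsub>Aut G T\<^esub> h) x, (inv\<^bsub>Aut G T\<^esub> g) x) \<in> lower_entourage G V)"
  using assms unfolding lower_nbhd_def by (auto simp: Aut_inv_eq subset_iff)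

lemma group_boundedD: "group_bounded G T B \<Longrightarrow> B \<subseteq> carrier G"
  unfolding group_bounded_def by blast

lemma Aut_image_group_bounded:
  assumes f: "f \<in> carrier (Aut G T)" and B: "group_bounded G T B"
  shows "group_bounded G T (f ` B)"
  unfolding group_bounded_def
proof (intro conjI allI impI)
  show "f ` B \<subseteq> carrier G"
    using Aut_apply_closed(1)[OF f] group_boundedD[OF B] by blast
  fix V :: "nat \<Rightarrow> 'a set"
  assume V: "(\<forall>n. openin T (V n)) \<and> (\<forall>n. V n \<subseteq> V (Suc n)) \<and> \<Union> (range V) = carrier G \<and>
    (\<forall>n. V n <#> V n \<subseteq> V (Suc n))"
  define P where "P n = {x \<in> carrier G. f x \<in> V n}" for n
  have "openin T (P n)" for n
    using openin_continuous_map_preimage[OF Aut_continuous[OF f], of "V n"] V by (simp add: P_def)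
  moreover have "P n \<subseteq> P (Suc n)" for n
    using V by (auto simp: P_def)
  moreover have "\<Union> (range P) = carrier G"
    using V Aut_apply_closed(1)[OF f] by (fastforce simp: P_def)
  moreover have "P n <#> P n \<subseteq> P (Suc n)" for n
  proof
    fix z assume "z \<in> P n <#> P n"
    then obtain x y where xy: "x \<in> P n" "y \<in> P n" "z = x \<otimes> y"
      unfolding set_mult_def by blast
    then have "f z = f x \<otimes> f y"
      using Aut_hom[OF f] by (simp add: P_def hom_mult)
    then have "f z \<in> V n <#> V n"
      using xy unfolding set_mult_def P_def by blast
    then show "z \<in> P (Suc n)"
      using V xy by (auto simp: P_def)
  qed
  ultimately obtain k where "B \<subseteq> P k"
    using B unfolding group_bounded_def by blast
  then show "\<exists>k. f ` B \<subseteq> V k"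
    by (auto simp: P_def)
qed

lemma lower_nbhd_inv:
  assumes g: "g \<in> carrier (Aut G T)" and B: "B \<subseteq> carrier G" and h: "h \<in> lower_nbhd G T B V g"
  shows "inv\<^bsub>Aut G T\<^esub> h \<in> lower_nbhd G T B V (inv\<^bsub>Aut G T\<^esub> g)"
  using h unfolding lower_nbhd_iff[OF g B] lower_nbhd_iff[OF Aut_inv_closed[OF g] B]
  by (simp add: Aut_inv_closed group.inv_inv[OF group_Aut] g)

text \<open>Continuity of composition, one half of biconvergence. From \<open>(h' x, h x) \<in> lower_entourage G X\<close> one
  gets \<open>g' (h' x)\<close> close to \<open>g' (h x)\<close> once \<open>g'\<close> maps \<open>X\<close> into a small neighborhood. This holds if \<open>g\<close>
  does so and \<open>g'\<close> is uniformly close to \<open>g\<close> on \<open>X\<close>, which is why a bounded neighborhood \<open>U\<close> must be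
  available. The set \<open>C\<close> also contains \<open>h ` B\<close>, to compare \<open>g'\<close> with \<open>g\<close> at \<open>h x\<close>.\<close>

lemma lower_nbhd_compose:
  assumes U: "identity_nbhd G T U" "group_bounded G T U"
    and gh: "g \<in> carrier (Aut G T)" "h \<in> carrier (Aut G T)"
    and BV: "group_bounded G T B" "identity_nbhd G T V"
  shows "\<exists>C W D X. group_bounded G T C \<and> identity_nbhd G T W \<and>
    group_bounded G T D \<and> identity_nbhd G T X \<and>
    (\<forall>g'\<in>lower_nbhd G T C W g. \<forall>h'\<in>lower_nbhd G T D X h. \<forall>x\<in>B.
      (g' (h' x), g (h x)) \<in> lower_entourage G V)"
proof -
  obtain V' where V': "identity_nbhd G T V'" "\<And>a b. a \<in> V' \<Longrightarrow> b \<in> V' \<Longrightarrow> a \<otimes> b \<in> V"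
    using identity_nbhd_symmetric_square[OF BV(2)] by metis
  obtain W where W: "identity_nbhd G T W" "W \<subseteq> V'"
      "\<And>a b c. a \<in> W \<Longrightarrow> b \<in> W \<Longrightarrow> c \<in> W \<Longrightarrow> a \<otimes> b \<otimes> c \<in> V'"
    using identity_nbhd_symmetric_cube[OF V'(1)] by metis
  note V'G = identity_nbhdD(1)[OF V'(1)] and WG = identity_nbhdD(1)[OF W(1)]
  let ?C = "U \<union> h ` B"
  let ?X = "U \<inter> {v \<in> carrier G. g v \<in> W}"
  have C: "group_bounded G T ?C"
    using U(2) Aut_image_group_bounded[OF gh(2) BV(1)] by (rule group_bounded_Un)
  have X: "identity_nbhd G T ?X"
    using U(1) Aut_identity_nbhd[OF gh(1) W(1)] by (rule identity_nbhd_Int)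
  have "(g' (h' x), g (h x)) \<in> lower_entourage G V"
    if g': "g' \<in> lower_nbhd G T ?C W g" and h': "h' \<in> lower_nbhd G T B ?X h" and x: "x \<in> B" for g' h' x
  proof -
    have g'A: "g' \<in> carrier (Aut G T)"
      using g' unfolding lower_nbhd_def by blast
    have "g' v \<in> V'" if v: "v \<in> ?X" for v
    proof -
      have "(g' v, g v) \<in> lower_entourage G W"
        using g' v unfolding lower_nbhd_def by blast
      then show ?thesis
        using v W(3) unfolding lower_entourage_iff[OF WG] by auto
    qed
    moreover have "(h' x, h x) \<in> lower_entourage G ?X"
      using h' x unfolding lower_nbhd_def by blast
    ultimately have 1: "(g' (h' x), g' (h x)) \<in> lower_entourage G V'"
      using lower_entourage_hom[OF Aut_hom[OF g'A] identity_nbhdD(1)[OF X] V'G] by blast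
    have "(g' (h x), g (h x)) \<in> lower_entourage G W"
      using g' x unfolding lower_nbhd_def by blast
    then have 2: "(g' (h x), g (h x)) \<in> lower_entourage G V'"
      using lower_entourage_mono[OF W(2)] by blast
    show ?thesis
      using V'G V'(2) 1 2 by (rule lower_entourage_trans')
  qed
  then show ?thesis
    using C W(1) BV(1) X by blast
qed

theorem topological_group_Aut:
  assumes U: "identity_nbhd G T U" "group_bounded G T U"
  shows "topological_group (Aut G T) (lower_topology G T)"
proof -
  let ?A = "Aut G T" and ?S = "lower_topology G T"
  interpret A: group ?A
    by (rule group_Aut)
  show ?thesis
  proof
    show "topspace ?S = carrier ?A"
      by (rule topspace_lower_topology)
    show "continuous_map ?S ?S (\<lambda>f. inv\<^bsub>?A\<^esub> f)"
      unfolding continuous_map_def topspace_lower_topology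
    proof (intro conjI allI impI)
      show "(\<lambda>f. inv\<^bsub>?A\<^esub> f) \<in> carrier ?A \<rightarrow> carrier ?A"
        by simp
      fix \<U> assume \<U>: "openin ?S \<U>"
      show "openin ?S {f \<in> carrier ?A. inv\<^bsub>?A\<^esub> f \<in> \<U>}"
        unfolding openin_lower_topology
      proof (intro conjI ballI)
        fix f assume "f \<in> {f \<in> carrier ?A. inv\<^bsub>?A\<^esub> f \<in> \<U>}"
        then have f: "f \<in> carrier ?A" "inv\<^bsub>?A\<^esub> f \<in> \<U>"
          by auto
        then obtain B V where BV: "group_bounded G T B" "identity_nbhd G T V"
            "lower_nbhd G T B V (inv\<^bsub>?A\<^esub> f) \<subseteq> \<U>"
          using \<U> unfolding openin_lower_topology by blast
        then have "lower_nbhd G T B V f \<subseteq> {f \<in> carrier ?A. inv\<^bsub>?A\<^esub> f \<in> \<U>}"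
          using lower_nbhd_inv[OF f(1) group_boundedD[OF BV(1)]] unfolding lower_nbhd_def by blast
        then show "\<exists>B V. group_bounded G T B \<and> identity_nbhd G T V \<and>
            lower_nbhd G T B V f \<subseteq> {f \<in> carrier ?A. inv\<^bsub>?A\<^esub> f \<in> \<U>}"
          using BV by blast
      qed blast
    qed
    show "continuous_map (prod_topology ?S ?S) ?S (\<lambda>(f, g). f \<otimes>\<^bsub>?A\<^esub> g)"
      unfolding continuous_map_def topspace_prod_topology topspace_lower_topology
    proof (intro conjI allI impI)
      show "(\<lambda>(f, g). f \<otimes>\<^bsub>?A\<^esub> g) \<in> carrier ?A \<times> carrier ?A \<rightarrow> carrier ?A"
        by auto
      fix \<U> assume \<U>: "openin ?S \<U>"
      let ?M = "{p \<in> carrier ?A \<times> carrier ?A. (case p of (f, g) \<Rightarrow> f \<otimes>\<^bsub>?A\<^esub> g) \<in> \<U>}"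
      show "openin (prod_topology ?S ?S) ?M"
        unfolding openin_prod_topology_alt
      proof (intro allI impI)
        fix g h assume "(g, h) \<in> ?M"
        then have gh: "g \<in> carrier ?A" "h \<in> carrier ?A" "g \<otimes>\<^bsub>?A\<^esub> h \<in> \<U>"
          by auto
        then have ghi: "inv\<^bsub>?A\<^esub> g \<in> carrier ?A" "inv\<^bsub>?A\<^esub> h \<in> carrier ?A" "g \<otimes>\<^bsub>?A\<^esub> h \<in> carrier ?A"
          by auto
        obtain B V where BV: "group_bounded G T B" "identity_nbhd G T V"
            "lower_nbhd G T B V (g \<otimes>\<^bsub>?A\<^esub> h) \<subseteq> \<U>"
          using \<U> gh(3) unfolding openin_lower_topology by blast
        obtain C W D X where 1: "group_bounded G T C" "identity_nbhd G T W" "group_bounded G T D" "identity_nbhd G T X"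
            "\<And>g' h' x. g' \<in> lower_nbhd G T C W g \<Longrightarrow> h' \<in> lower_nbhd G T D X h \<Longrightarrow> x \<in> B \<Longrightarrow>
              (g' (h' x), g (h x)) \<in> lower_entourage G V"
          using lower_nbhd_compose[OF U gh(1,2) BV(1,2)] by metis
        \<comment> \<open>The other half of biconvergence is the same estimate for the inverses in reverse order.\<close>
        obtain C' W' D' X' where 2: "group_bounded G T C'" "identity_nbhd G T W'" "group_bounded G T D'" "identity_nbhd G T X'"
            "\<And>g' h' x. g' \<in> lower_nbhd G T C' W' (inv\<^bsub>?A\<^esub> h) \<Longrightarrow> h' \<in> lower_nbhd G T D' X' (inv\<^bsub>?A\<^esub> g) \<Longrightarrow> x \<in> B \<Longrightarrow>
              (g' (h' x), (inv\<^bsub>?A\<^esub> h) ((inv\<^bsub>?A\<^esub> g) x)) \<in> lower_entourage G V"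
          using lower_nbhd_compose[OF U ghi(2,1) BV(1,2)] by metis
        have bdd: "group_bounded G T (C \<union> D')" "group_bounded G T (D \<union> C')"
          "identity_nbhd G T (W \<inter> X')" "identity_nbhd G T (X \<inter> W')"
          using 1 2 by (simp_all add: group_bounded_Un identity_nbhd_Int)
        obtain P where P: "openin ?S P" "g \<in> P" "P \<subseteq> lower_nbhd G T (C \<union> D') (W \<inter> X') g"
          using lower_nbhd_open_subset[OF bdd(1,3) gh(1)] .
        obtain Q where Q: "openin ?S Q" "h \<in> Q" "Q \<subseteq> lower_nbhd G T (D \<union> C') (X \<inter> W') h"
          using lower_nbhd_open_subset[OF bdd(2,4) gh(2)] .
        have "g' \<otimes>\<^bsub>?A\<^esub> h' \<in> \<U>" if "g' \<in> P" "h' \<in> Q" for g' h'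
        proof -
          have near: "g' \<in> lower_nbhd G T C W g" "g' \<in> lower_nbhd G T D' X' g"
            "h' \<in> lower_nbhd G T D X h" "h' \<in> lower_nbhd G T C' W' h"
            using subsetD[OF P(3) that(1)] subsetD[OF Q(3) that(2)]
            by (elim subsetD[OF lower_nbhd_mono, rotated -1]; simp)+
          then have A: "g' \<in> carrier ?A" "h' \<in> carrier ?A"
            unfolding lower_nbhd_def by blast+
          have inv_near: "inv\<^bsub>?A\<^esub> g' \<in> lower_nbhd G T D' X' (inv\<^bsub>?A\<^esub> g)"
            "inv\<^bsub>?A\<^esub> h' \<in> lower_nbhd G T C' W' (inv\<^bsub>?A\<^esub> h)"
            using near lower_nbhd_inv gh group_boundedD 1 2 by blast+
          have "g' \<otimes>\<^bsub>?A\<^esub> h' \<in> lower_nbhd G T B V (g \<otimes>\<^bsub>?A\<^esub> h)"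
            unfolding lower_nbhd_iff[OF ghi(3) group_boundedD[OF BV(1)]]
          proof (intro conjI ballI)
            fix x assume x: "x \<in> B"
            then have xG: "x \<in> carrier G"
              using group_boundedD[OF BV(1)] by blast
            show "((g' \<otimes>\<^bsub>?A\<^esub> h') x, (g \<otimes>\<^bsub>?A\<^esub> h) x) \<in> lower_entourage G V"
              using 1(5)[OF near(1,3) x] by (simp add: Aut_mult_apply A gh xG)
            show "((inv\<^bsub>?A\<^esub> (g' \<otimes>\<^bsub>?A\<^esub> h')) x, (inv\<^bsub>?A\<^esub> (g \<otimes>\<^bsub>?A\<^esub> h)) x) \<in> lower_entourage G V"
              using 2(5)[OF inv_near(2,1) x] by (simp add: Aut_mult_apply A.inv_mult_group A gh xG)
          qed (use A in simp)
          then show ?thesis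
            using BV(3) by blast
        qed
        moreover have "P \<subseteq> carrier ?A" "Q \<subseteq> carrier ?A"
          using P(3) Q(3) unfolding lower_nbhd_def by blast+
        ultimately have "P \<times> Q \<subseteq> ?M"
          by auto
        then show "\<exists>P Q. openin ?S P \<and> openin ?S Q \<and> g \<in> P \<and> h \<in> Q \<and> P \<times> Q \<subseteq> ?M"
          using P Q by blast
      qed
    qed
  qed
qed

lemma lower_nbhd_identity_nbhd:
  assumes BV: "group_bounded G T B" "identity_nbhd G T V"
  shows "identity_nbhd (Aut G T) (lower_topology G T) (lower_nbhd G T B V \<one>\<^bsub>Aut G T\<^esub>)"
proof -
  have "\<one>\<^bsub>Aut G T\<^esub> \<in> carrier (Aut G T)"
    using group_Aut by (simp add: group.is_monoid)
  from lower_nbhd_open_subset[OF BV this] show ?thesis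
    unfolding identity_nbhd_def topspace_lower_topology by (metis (no_types, lifting) lower_nbhd_def mem_Collect_eq subsetI)
qed

section \<open>Two-sided completeness of the automorphism group\<close>

lemma two_sided_Cauchy_AutD:
  assumes \<sigma>: "two_sided_Cauchy (Aut G T) (lower_topology G T) \<sigma>"
    and BV: "group_bounded G T B" "identity_nbhd G T V"
  shows "\<exists>N. \<forall>m\<ge>N. \<forall>n\<ge>N. \<forall>x\<in>B.
    ((inv\<^bsub>Aut G T\<^esub> \<sigma> m) (\<sigma> n x), x) \<in> lower_entourage G V \<and>
    (\<sigma> m ((inv\<^bsub>Aut G T\<^esub> \<sigma> n) x), x) \<in> lower_entourage G V"
proof -
  let ?A = "Aut G T"
  interpret A: group ?A
    by (rule group_Aut)
  have \<sigma>A: "\<sigma> n \<in> carrier ?A" for n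
    using \<sigma> unfolding two_sided_Cauchy_def by blast
  obtain N where N: "\<And>m n. N \<le> m \<Longrightarrow> N \<le> n \<Longrightarrow>
      inv\<^bsub>?A\<^esub> \<sigma> m \<otimes>\<^bsub>?A\<^esub> \<sigma> n \<in> lower_nbhd G T B V \<one>\<^bsub>?A\<^esub> \<and>
      \<sigma> m \<otimes>\<^bsub>?A\<^esub> inv\<^bsub>?A\<^esub> \<sigma> n \<in> lower_nbhd G T B V \<one>\<^bsub>?A\<^esub>"
    using \<sigma> lower_nbhd_identity_nbhd[OF BV] unfolding two_sided_Cauchy_def by blast
  show ?thesis
  proof (intro exI[of _ N] allI impI ballI)
    fix m n x assume mn: "N \<le> m" "N \<le> n" and x: "x \<in> B"
    have xG: "x \<in> carrier G"
      using x group_boundedD[OF BV(1)] by blast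
    show "((inv\<^bsub>?A\<^esub> \<sigma> m) (\<sigma> n x), x) \<in> lower_entourage G V \<and>
      (\<sigma> m ((inv\<^bsub>?A\<^esub> \<sigma> n) x), x) \<in> lower_entourage G V"
    proof -
      have "((inv\<^bsub>?A\<^esub> \<sigma> m \<otimes>\<^bsub>?A\<^esub> \<sigma> n) x, \<one>\<^bsub>?A\<^esub> x) \<in> lower_entourage G V"
        "((\<sigma> m \<otimes>\<^bsub>?A\<^esub> inv\<^bsub>?A\<^esub> \<sigma> n) x, \<one>\<^bsub>?A\<^esub> x) \<in> lower_entourage G V"
        using N[OF mn] x unfolding lower_nbhd_iff[OF A.one_closed group_boundedD[OF BV(1)]] by blast+
      then show ?thesis
        using xG by (simp add: Aut_mult_apply Aut_one_apply \<sigma>A)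
    qed
  qed
qed

text \<open>For \<open>n \<ge> N\<close> the automorphism \<open>\<sigma> n\<close> is \<open>\<sigma> N\<close> followed by a map that is uniformly close to the identity on
  the bounded set \<open>U\<close>; the continuity of \<open>\<sigma> N\<close> alone thus gives a common neighborhood \<open>W\<close>.\<close>

lemma two_sided_Cauchy_Aut_equicontinuous:
  assumes U: "identity_nbhd G T U" "group_bounded G T U"
    and \<sigma>: "two_sided_Cauchy (Aut G T) (lower_topology G T) \<sigma>"
    and V: "identity_nbhd G T V"
  shows "\<exists>W N. identity_nbhd G T W \<and> (\<forall>n\<ge>N. \<forall>w\<in>W. \<sigma> n w \<in> V)"
proof -
  let ?A = "Aut G T"
  have \<sigma>A: "\<sigma> n \<in> carrier ?A" for n
    using \<sigma> unfolding two_sided_Cauchy_def by blast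
  obtain P where P: "identity_nbhd G T P" "\<And>a b c. a \<in> P \<Longrightarrow> b \<in> P \<Longrightarrow> c \<in> P \<Longrightarrow> a \<otimes> b \<otimes> c \<in> V"
    using identity_nbhd_symmetric_cube[OF V] by metis
  obtain N where N: "\<And>m n x. N \<le> m \<Longrightarrow> N \<le> n \<Longrightarrow> x \<in> U \<Longrightarrow>
      (\<sigma> m ((inv\<^bsub>?A\<^esub> \<sigma> n) x), x) \<in> lower_entourage G P"
    using two_sided_Cauchy_AutD[OF \<sigma> U(2) P(1)] by blast
  let ?W = "{w \<in> carrier G. \<sigma> N w \<in> U \<inter> P}"
  have "identity_nbhd G T ?W"
    using Aut_identity_nbhd[OF \<sigma>A identity_nbhd_Int[OF U(1) P(1)]] .
  moreover have "\<sigma> n w \<in> V" if "N \<le> n" "w \<in> ?W" for n w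
  proof -
    have "(\<sigma> n ((inv\<^bsub>?A\<^esub> \<sigma> N) (\<sigma> N w)), \<sigma> N w) \<in> lower_entourage G P"
      using N[OF that(1) order_refl] that(2) by simp
    then have "(\<sigma> n w, \<sigma> N w) \<in> lower_entourage G P"
      using Aut_inv_apply(2)[OF \<sigma>A] that(2) by simp
    then show ?thesis
      using that(2) P(2) unfolding lower_entourage_iff[OF identity_nbhdD(1)[OF P(1)]] by auto
  qed
  ultimately show ?thesis
    by blast
qed

text \<open>The differences \<open>inv (\<sigma> m x) \<otimes> \<sigma> n x\<close> are images under \<open>\<sigma> m\<close> of elements close to \<open>\<one>\<close>, so
  equicontinuity makes \<open>\<sigma> n x\<close> two-sided Cauchy in the group itself. It also makes the limit
  homomorphism continuous.\<close>

lemma two_sided_Cauchy_Aut_pointwise_limit: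
  assumes U: "identity_nbhd G T U" "group_bounded G T U"
    and Haus: "Hausdorff_space T"
    and complete: "\<And>\<tau>. two_sided_Cauchy G T \<tau> \<Longrightarrow> \<exists>x. limitin T \<tau> x sequentially"
    and \<sigma>: "two_sided_Cauchy (Aut G T) (lower_topology G T) \<sigma>"
  obtains L where "\<And>x. x \<in> carrier G \<Longrightarrow> limitin T (\<lambda>n. \<sigma> n x) (L x) sequentially"
    and "L \<in> hom G G" and "continuous_map T T L"
proof -
  let ?A = "Aut G T"
  interpret A: group ?A
    by (rule group_Aut)
  have \<sigma>A: "\<sigma> n \<in> carrier ?A" for n
    using \<sigma> unfolding two_sided_Cauchy_def by blast
  have \<sigma>G: "\<sigma> n x \<in> carrier G" "(inv\<^bsub>?A\<^esub> \<sigma> n) x \<in> carrier G" if "x \<in> carrier G" for n x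
    using Aut_apply_closed(1) \<sigma>A that by auto
  have "two_sided_Cauchy G T (\<lambda>n. \<sigma> n x)" if x: "x \<in> carrier G" for x
    unfolding two_sided_Cauchy_def
  proof (intro conjI allI impI)
    show "range (\<lambda>n. \<sigma> n x) \<subseteq> carrier G"
      using \<sigma>G x by auto
    fix V assume "identity_nbhd G T V"
    then obtain W N where W: "identity_nbhd G T W" "\<And>n w. N \<le> n \<Longrightarrow> w \<in> W \<Longrightarrow> \<sigma> n w \<in> V"
      using two_sided_Cauchy_Aut_equicontinuous[OF U \<sigma>] by metis
    obtain W' where W': "identity_nbhd G T W'"
        "\<And>y. (y, x) \<in> lower_entourage G W' \<Longrightarrow> inv x \<otimes> y \<in> W \<and> y \<otimes> inv x \<in> W"
      using lower_entourage_topology[OF W(1) x] by metis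
    have "group_bounded G T {x}"
      using x unfolding group_bounded_def by fast
    then obtain N' where N': "\<And>m n. N' \<le> m \<Longrightarrow> N' \<le> n \<Longrightarrow>
        ((inv\<^bsub>?A\<^esub> \<sigma> m) (\<sigma> n x), x) \<in> lower_entourage G W'"
      using two_sided_Cauchy_AutD[OF \<sigma> _ W'(1)] by blast
    have "inv (\<sigma> m x) \<otimes> \<sigma> n x \<in> V \<and> \<sigma> m x \<otimes> inv (\<sigma> n x) \<in> V"
      if mn: "max N N' \<le> m" "max N N' \<le> n" for m n
    proof
      interpret m: group_hom G G "\<sigma> m"
        using Aut_hom[OF \<sigma>A] by (rule hom_group_hom)
      interpret n: group_hom G G "\<sigma> n"
        using Aut_hom[OF \<sigma>A] by (rule hom_group_hom)
      have "inv (\<sigma> m x) \<otimes> \<sigma> n x = \<sigma> m (inv x \<otimes> (inv\<^bsub>?A\<^esub> \<sigma> m) (\<sigma> n x))"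
        using x \<sigma>G by (simp add: Aut_inv_apply(1)[OF \<sigma>A])
      moreover have "inv x \<otimes> (inv\<^bsub>?A\<^esub> \<sigma> m) (\<sigma> n x) \<in> W"
        using W'(2)[OF N'[of m n]] mn by simp
      ultimately show "inv (\<sigma> m x) \<otimes> \<sigma> n x \<in> V"
        using W(2)[of m] mn by simp
      have "\<sigma> m x \<otimes> inv (\<sigma> n x) = \<sigma> n ((inv\<^bsub>?A\<^esub> \<sigma> n) (\<sigma> m x) \<otimes> inv x)"
        using x \<sigma>G by (simp add: Aut_inv_apply(1)[OF \<sigma>A])
      moreover have "(inv\<^bsub>?A\<^esub> \<sigma> n) (\<sigma> m x) \<otimes> inv x \<in> W"
        using W'(2)[OF N'[of n m]] mn by simp
      ultimately show "\<sigma> m x \<otimes> inv (\<sigma> n x) \<in> V"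
        using W(2)[of n] mn by simp
    qed
    then show "\<exists>N. \<forall>m\<ge>N. \<forall>n\<ge>N. inv (\<sigma> m x) \<otimes> \<sigma> n x \<in> V \<and> \<sigma> m x \<otimes> inv (\<sigma> n x) \<in> V"
      by blast
  qed
  then have "\<exists>y. limitin T (\<lambda>n. \<sigma> n x) y sequentially" if "x \<in> carrier G" for x
    using complete that by blast
  then obtain L where L: "\<And>x. x \<in> carrier G \<Longrightarrow> limitin T (\<lambda>n. \<sigma> n x) (L x) sequentially"
    by metis
  have LG: "L x \<in> carrier G" if "x \<in> carrier G" for x
    using limitin_topspace[OF L[OF that]] by simp
  have hom: "L \<in> hom G G"
    unfolding hom_def
  proof (intro CollectI conjI ballI)
    show "L \<in> carrier G \<rightarrow> carrier G"
      using LG by auto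
    fix x y assume xy: "x \<in> carrier G" "y \<in> carrier G"
    have "limitin T (\<lambda>n. \<sigma> n x \<otimes> \<sigma> n y) (L x \<otimes> L y) sequentially"
      using L xy by (intro limitin_mult)
    then have "limitin T (\<lambda>n. \<sigma> n (x \<otimes> y)) (L x \<otimes> L y) sequentially"
      by (simp add: hom_mult[OF Aut_hom[OF \<sigma>A] xy])
    then show "L (x \<otimes> y) = L x \<otimes> L y"
      using limitin_Hausdorff_unique[OF L _ _ Haus] xy by simp
  qed
  have "continuous_map T T L"
  proof (rule hom_continuous_map[OF hom])
    fix V assume "identity_nbhd G T V"
    then obtain P where P: "identity_nbhd G T P" "\<And>a. a \<in> P \<Longrightarrow> inv a \<in> P"
        "\<And>a b. a \<in> P \<Longrightarrow> b \<in> P \<Longrightarrow> a \<otimes> b \<in> V"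
      using identity_nbhd_symmetric_square by metis
    obtain W N where W: "identity_nbhd G T W" "\<And>n w. N \<le> n \<Longrightarrow> w \<in> W \<Longrightarrow> \<sigma> n w \<in> P"
      using two_sided_Cauchy_Aut_equicontinuous[OF U \<sigma> P(1)] by metis
    have "L w \<in> V" if w: "w \<in> W" for w
    proof -
      have wG: "w \<in> carrier G"
        using w identity_nbhdD(1)[OF W(1)] by blast
      have "\<forall>\<^sub>F n in sequentially. \<sigma> n w \<in> P"
        using W(2) w unfolding eventually_sequentially by blast
      then show ?thesis
        using limitin_in_nbhd[OF L[OF wG] _ _ P] \<sigma>G(1)[OF wG] by simp
    qed
    with W(1) show "\<exists>W. identity_nbhd G T W \<and> (\<forall>w\<in>W. L w \<in> V)"
      by blast
  qed
  with L hom show thesis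
    by (rule that)
qed

text \<open>Since \<open>\<sigma> n\<close> maps \<open>(inv \<sigma> n) x\<close>, which is close to \<open>y\<close>, to \<open>x\<close>, equicontinuity shows that \<open>\<sigma> n y\<close> tends
  to \<open>x\<close>.\<close>

lemma two_sided_Cauchy_Aut_limit_inverse:
  assumes U: "identity_nbhd G T U" "group_bounded G T U"
    and Haus: "Hausdorff_space T"
    and \<sigma>: "two_sided_Cauchy (Aut G T) (lower_topology G T) \<sigma>"
    and xy: "x \<in> carrier G" "limitin T (\<lambda>n. (inv\<^bsub>Aut G T\<^esub> \<sigma> n) x) y sequentially"
    and z: "limitin T (\<lambda>n. \<sigma> n y) z sequentially"
  shows "z = x"
proof -
  let ?A = "Aut G T"
  interpret A: group ?A
    by (rule group_Aut)
  have \<sigma>A: "\<sigma> n \<in> carrier ?A" for n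
    using \<sigma> unfolding two_sided_Cauchy_def by blast
  have \<sigma>G: "\<sigma> n x \<in> carrier G" "(inv\<^bsub>?A\<^esub> \<sigma> n) x \<in> carrier G" if "x \<in> carrier G" for n x
    using Aut_apply_closed(1) \<sigma>A that by auto
  have y: "y \<in> carrier G"
    using limitin_topspace[OF xy(2)] by simp
  have "limitin T (\<lambda>n. \<sigma> n y) x sequentially"
    unfolding limitin_iff_identity_nbhd[of "\<lambda>n. \<sigma> n y", OF \<sigma>G(1)[OF y]]
  proof (intro conjI allI impI xy(1))
    fix V assume "identity_nbhd G T V"
    then obtain W N where W: "identity_nbhd G T W" "\<And>n w. N \<le> n \<Longrightarrow> w \<in> W \<Longrightarrow> \<sigma> n w \<in> V"
      using two_sided_Cauchy_Aut_equicontinuous[OF U \<sigma>] by metis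
    have "identity_nbhd G T {w \<in> carrier G. inv w \<in> W}"
      using W(1) by (intro identity_nbhd_vimage continuous_map_group) simp_all
    then have "\<forall>\<^sub>F n in sequentially. inv y \<otimes> (inv\<^bsub>?A\<^esub> \<sigma> n) x \<in> {w \<in> carrier G. inv w \<in> W}"
      using xy(2) unfolding limitin_iff_identity_nbhd[of "\<lambda>n. (inv\<^bsub>?A\<^esub> \<sigma> n) x", OF \<sigma>G(2)[OF xy(1)]] by blast
    moreover have "\<forall>\<^sub>F n in sequentially. N \<le> n"
      by (rule eventually_ge_at_top)
    ultimately show "\<forall>\<^sub>F n in sequentially. inv x \<otimes> \<sigma> n y \<in> V"
    proof eventually_elim
      case (elim n)
      interpret n: group_hom G G "\<sigma> n"
        using Aut_hom[OF \<sigma>A] by (rule hom_group_hom)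
      have "inv (inv y \<otimes> (inv\<^bsub>?A\<^esub> \<sigma> n) x) = inv ((inv\<^bsub>?A\<^esub> \<sigma> n) x) \<otimes> y"
        using y \<sigma>G(2)[OF xy(1)] by (simp add: inv_mult_group)
      then have "\<sigma> n (inv ((inv\<^bsub>?A\<^esub> \<sigma> n) x) \<otimes> y) \<in> V"
        using elim W(2) by simp
      moreover have "\<sigma> n (inv ((inv\<^bsub>?A\<^esub> \<sigma> n) x) \<otimes> y) = inv x \<otimes> \<sigma> n y"
        using xy(1) y \<sigma>G(2)[OF xy(1)] by (simp add: Aut_inv_apply(1)[OF \<sigma>A])
      ultimately show ?case
        by simp
    qed
  qed
  then show ?thesis
    using limitin_Hausdorff_unique[OF z _ _ Haus] by simp
qed

text \<open>Uniform closeness of \<open>(inv \<sigma> n) (\<sigma> m x)\<close> to \<open>x\<close> is carried by the equicontinuous map \<open>\<sigma> n\<close> to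
  uniform closeness of \<open>\<sigma> m x\<close> to \<open>\<sigma> n x\<close>; for each single \<open>x\<close> one then lets \<open>m\<close> tend to infinity.\<close>

lemma two_sided_Cauchy_Aut_uniform:
  assumes U: "identity_nbhd G T U" "group_bounded G T U"
    and \<sigma>: "two_sided_Cauchy (Aut G T) (lower_topology G T) \<sigma>"
    and L: "\<And>x. x \<in> carrier G \<Longrightarrow> limitin T (\<lambda>n. \<sigma> n x) (L x) sequentially"
    and BV: "group_bounded G T B" "identity_nbhd G T V"
  shows "\<forall>\<^sub>F n in sequentially. \<forall>x\<in>B. (\<sigma> n x, L x) \<in> lower_entourage G V"
proof -
  let ?A = "Aut G T"
  have \<sigma>A: "\<sigma> n \<in> carrier ?A" for n
    using \<sigma> unfolding two_sided_Cauchy_def by blast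
  have \<sigma>G: "\<sigma> n x \<in> carrier G" if "x \<in> carrier G" for n x
    using Aut_apply_closed(1) \<sigma>A that by auto
  obtain P where P: "identity_nbhd G T P" "\<And>a. a \<in> P \<Longrightarrow> inv a \<in> P"
      "\<And>a b. a \<in> P \<Longrightarrow> b \<in> P \<Longrightarrow> a \<otimes> b \<in> V"
    using identity_nbhd_symmetric_square[OF BV(2)] by metis
  note PG = identity_nbhdD(1)[OF P(1)]
  obtain W N where W: "identity_nbhd G T W" "\<And>n w. N \<le> n \<Longrightarrow> w \<in> W \<Longrightarrow> \<sigma> n w \<in> P"
    using two_sided_Cauchy_Aut_equicontinuous[OF U \<sigma> P(1)] by metis
  obtain N' where N': "\<And>m n x. N' \<le> m \<Longrightarrow> N' \<le> n \<Longrightarrow> x \<in> B \<Longrightarrow>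
      ((inv\<^bsub>?A\<^esub> \<sigma> m) (\<sigma> n x), x) \<in> lower_entourage G W"
    using two_sided_Cauchy_AutD[OF \<sigma> BV(1) W(1)] by blast
  have "(\<sigma> n x, L x) \<in> lower_entourage G V" if n: "max N N' \<le> n" and x: "x \<in> B" for n x
  proof -
    have xG: "x \<in> carrier G"
      using x group_boundedD[OF BV(1)] by blast
    have LxG: "L x \<in> carrier G"
      using limitin_topspace[OF L[OF xG]] by simp
    have "\<forall>\<^sub>F m in sequentially. inv (L x) \<otimes> \<sigma> m x \<in> P"
      using L[OF xG] P(1) unfolding limitin_iff_identity_nbhd[of "\<lambda>n. \<sigma> n x", OF \<sigma>G[OF xG]] by blast
    then obtain m where m: "N' \<le> m" "inv (L x) \<otimes> \<sigma> m x \<in> P"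
      unfolding eventually_sequentially by (meson le_cases)
    have "\<sigma> m x = \<one> \<otimes> L x \<otimes> (inv (L x) \<otimes> \<sigma> m x)"
      using LxG \<sigma>G[OF xG] by (simp add: inv_cancel_left)
    then have 1: "(\<sigma> m x, L x) \<in> lower_entourage G P"
      using m(2) LxG identity_nbhdD(2)[OF P(1)] unfolding lower_entourage_iff[OF PG] by blast
    have "(\<sigma> n ((inv\<^bsub>?A\<^esub> \<sigma> n) (\<sigma> m x)), \<sigma> n x) \<in> lower_entourage G P"
      using lower_entourage_hom[OF Aut_hom[OF \<sigma>A] identity_nbhdD(1)[OF W(1)] PG W(2)] N'[OF _ m(1) x] n by simp
    then have "(\<sigma> m x, \<sigma> n x) \<in> lower_entourage G P"
      using Aut_inv_apply(1)[OF \<sigma>A] \<sigma>G[OF xG] by simp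
    then have "(\<sigma> n x, \<sigma> m x) \<in> lower_entourage G P"
      using lower_entourage_sym[OF PG P(2)] by blast
    then show ?thesis
      using lower_entourage_trans'[OF PG P(3)] 1 by blast
  qed
  then show ?thesis
    unfolding eventually_sequentially by blast
qed

theorem Aut_two_sided_complete:
  assumes U: "identity_nbhd G T U" "group_bounded G T U"
    and Haus: "Hausdorff_space T"
    and complete: "\<And>\<tau>. two_sided_Cauchy G T \<tau> \<Longrightarrow> \<exists>x. limitin T \<tau> x sequentially"
    and \<sigma>: "two_sided_Cauchy (Aut G T) (lower_topology G T) \<sigma>"
  shows "\<exists>f. limitin (lower_topology G T) \<sigma> f sequentially"
proof -
  let ?A = "Aut G T" and ?S = "lower_topology G T"
  interpret A: topological_group ?A ?S
    by (rule topological_group_Aut[OF U])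
  have \<sigma>A: "\<sigma> n \<in> carrier ?A" for n
    using \<sigma> unfolding two_sided_Cauchy_def by blast
  define \<tau> where "\<tau> n = inv\<^bsub>?A\<^esub> \<sigma> n" for n
  have \<tau>: "two_sided_Cauchy ?A ?S \<tau>"
    unfolding \<tau>_def by (rule A.two_sided_Cauchy_inv[OF \<sigma>])
  have \<tau>_inv: "inv\<^bsub>?A\<^esub> \<tau> n = \<sigma> n" for n
    by (simp add: \<tau>_def \<sigma>A)
  obtain L where L: "\<And>x. x \<in> carrier G \<Longrightarrow> limitin T (\<lambda>n. \<sigma> n x) (L x) sequentially"
      "L \<in> hom G G" "continuous_map T T L"
    using two_sided_Cauchy_Aut_pointwise_limit[OF U Haus complete \<sigma>] by blast
  obtain K where K: "\<And>x. x \<in> carrier G \<Longrightarrow> limitin T (\<lambda>n. \<tau> n x) (K x) sequentially"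
      "K \<in> hom G G" "continuous_map T T K"
    using two_sided_Cauchy_Aut_pointwise_limit[OF U Haus complete \<tau>] by blast
  have in_G: "L x \<in> carrier G" "K x \<in> carrier G" if "x \<in> carrier G" for x
    using limitin_topspace[OF L(1)[OF that]] limitin_topspace[OF K(1)[OF that]] by simp_all
  have LK: "L (K x) = x" if "x \<in> carrier G" for x
    using two_sided_Cauchy_Aut_limit_inverse[OF U Haus \<sigma> that _ L(1)[OF in_G(2)[OF that]]] K(1)[OF that]
    unfolding \<tau>_def by blast
  have KL: "K (L x) = x" if "x \<in> carrier G" for x
    using two_sided_Cauchy_Aut_limit_inverse[OF U Haus \<tau> that _ K(1)[OF in_G(1)[OF that]]] L(1)[OF that]
    unfolding \<tau>_inv by blast
  define f where "f = restrict L (carrier G)"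
  have "homeomorphic_maps T T L K"
    using L(3) K(3) LK KL by (simp add: homeomorphic_maps_def)
  then have "homeomorphic_maps T T f K"
    by (rule homeomorphic_maps_eq) (simp_all add: f_def)
  moreover have "f \<in> hom G G"
    using L(2) by (auto simp: f_def hom_def Pi_iff)
  ultimately have f: "f \<in> carrier ?A"
    unfolding Aut_iff by (auto simp: f_def)
  have f_inv: "(inv\<^bsub>?A\<^esub> f) x = K x" if "x \<in> carrier G" for x
    using Aut_inv_apply(2)[OF f in_G(2)[OF that]] LK[OF that] in_G(2)[OF that] by (simp add: f_def)
  have "limitin ?S \<sigma> f sequentially"
    unfolding limitin_lower_topology[OF always_eventually[OF allI[OF \<sigma>A]]]
  proof (intro conjI allI impI f)
    fix B V assume "group_bounded G T B \<and> identity_nbhd G T V"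
    then have BV: "group_bounded G T B" "identity_nbhd G T V"
      by auto
    have BG: "x \<in> carrier G" if "x \<in> B" for x
      using that group_boundedD[OF BV(1)] by blast
    show "\<forall>\<^sub>F n in sequentially. \<forall>x\<in>B. (\<sigma> n x, f x) \<in> lower_entourage G V"
      using two_sided_Cauchy_Aut_uniform[OF U \<sigma> L(1) BV] by (simp add: f_def BG cong: ball_cong)
    have "\<forall>\<^sub>F n in sequentially. \<forall>x\<in>B. (\<tau> n x, K x) \<in> lower_entourage G V"
      using two_sided_Cauchy_Aut_uniform[OF U \<tau> K(1) BV] .
    then show "\<forall>\<^sub>F n in sequentially. \<forall>x\<in>B.
        (inv_into (carrier G) (\<sigma> n) x, inv_into (carrier G) f x) \<in> lower_entourage G V"
      by (rule eventually_mono)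
        (use BG f_inv in \<open>force simp: \<tau>_def Aut_inv_eq[OF \<sigma>A] Aut_inv_eq[OF f]\<close>)
  qed
  then show ?thesis
    by blast
qed

section \<open>Separability of the automorphism group\<close>

text \<open>A label \<open>(i, cs)\<close> of \<open>f\<close> consists of the index of a basic neighborhood with \<open>f ` N i \<subseteq> W\<close> and of a
  list \<open>cs\<close> from a countable dense set that approximates the values of \<open>f\<close> on a finite \<open>N i\<close>-net of \<open>B\<close>.
  Each \<open>x\<close> in \<open>B\<close> is \<open>N i\<close>-close to a point of the net, so \<open>f x\<close> is close to the entry of \<open>cs\<close> at that
  point, and two automorphisms with a common label are uniformly close on \<open>B\<close>.\<close>

lemma Aut_countable_approximation:
  assumes sep: "separable_space T"
    and N: "\<And>n. identity_nbhd G T (N n)" "\<And>V. identity_nbhd G T V \<Longrightarrow> \<exists>n::nat. N n \<subseteq> V"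
    and B: "roelcke_precompact G T B" and V: "identity_nbhd G T V"
  shows "\<exists>(\<Theta> :: (nat \<times> 'a list) set) R. countable \<Theta> \<and> (\<forall>f\<in>carrier (Aut G T). \<exists>t\<in>\<Theta>. R f t) \<and>
    (\<forall>f\<in>carrier (Aut G T). \<forall>g\<in>carrier (Aut G T). \<forall>t. \<forall>x\<in>B. R f t \<longrightarrow> R g t \<longrightarrow>
      (f x, g x) \<in> lower_entourage G V)"
proof -
  obtain V' where V': "identity_nbhd G T V'" "\<And>a. a \<in> V' \<Longrightarrow> inv a \<in> V'"
      "\<And>a b. a \<in> V' \<Longrightarrow> b \<in> V' \<Longrightarrow> a \<otimes> b \<in> V"
    using identity_nbhd_symmetric_square[OF V] by metis
  obtain W where W: "identity_nbhd G T W" "\<And>a b. a \<in> W \<Longrightarrow> b \<in> W \<Longrightarrow> a \<otimes> b \<in> V'"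
    using identity_nbhd_symmetric_square[OF V'(1)] by metis
  note V'G = identity_nbhdD(1)[OF V'(1)] and WG = identity_nbhdD(1)[OF W(1)]
  obtain C where C: "countable C" "C \<subseteq> carrier G"
    and C_hits: "\<forall>S. openin T S \<and> S \<noteq> {} \<longrightarrow> C \<inter> S \<noteq> {}"
    using sep[unfolded separable_space_def dense_intersects_open, unfolded topspace_eq]
    by (elim exE conjE)
  have approx: "\<exists>c\<in>C. (y, c) \<in> lower_entourage G W" if y: "y \<in> carrier G" for y
  proof -
    obtain O' where O': "openin T O'" "\<one> \<in> O'" "O' \<subseteq> W"
      using W(1) unfolding identity_nbhd_def by blast
    let ?S = "{c \<in> carrier G. inv c \<otimes> y \<in> O'}"
    have "continuous_map T T (\<lambda>c. inv c \<otimes> y)"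
      using y by (intro continuous_map_group)
    then have "openin T ?S"
      using openin_continuous_map_preimage[OF _ O'(1), of T "\<lambda>c. inv c \<otimes> y"] by simp
    moreover have "y \<in> ?S"
      using y O' by simp
    ultimately obtain c where c: "c \<in> C" "c \<in> carrier G" "inv c \<otimes> y \<in> W"
      using C_hits O'(3) by blast
    have "y = \<one> \<otimes> c \<otimes> (inv c \<otimes> y)"
      using c y by (simp add: inv_cancel_left)
    then show ?thesis
      using c identity_nbhdD(2)[OF W(1)] unfolding lower_entourage_iff[OF WG] by blast
  qed
  have "\<exists>xs. set xs \<subseteq> carrier G \<and> (\<forall>x\<in>B. \<exists>y\<in>set xs. (x, y) \<in> lower_entourage G (N i))" for i
    using roelcke_precompactD(2)[OF B N(1)[of i]] finite_list by metis
  then obtain xs where xs: "\<And>i. set (xs i) \<subseteq> carrier G"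
      "\<And>i x. x \<in> B \<Longrightarrow> \<exists>y\<in>set (xs i). (x, y) \<in> lower_entourage G (N i)"
    by metis
  define R where "R f t = (case t of (i, cs) \<Rightarrow> (\<forall>v\<in>N i. f v \<in> W) \<and>
    list_all2 (\<lambda>y c. (f y, c) \<in> lower_entourage G W) (xs i) cs)" for f :: "'a \<Rightarrow> 'a" and t
  have near: "(f x, c) \<in> lower_entourage G V'"
    if f: "f \<in> carrier (Aut G T)" "R f (i, cs)"
      and x: "(x, y) \<in> lower_entourage G (N i)" "(f y, c) \<in> lower_entourage G W" for f i cs x y c
  proof -
    have "(f x, f y) \<in> lower_entourage G W"
      using lower_entourage_hom[OF Aut_hom[OF f(1)] identity_nbhdD(1)[OF N(1)] WG _ x(1)] f(2)
      by (simp add: R_def)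
    then show ?thesis
      using lower_entourage_trans'[OF WG W(2)] x(2) by blast
  qed
  show ?thesis
  proof (intro exI[of _ "UNIV \<times> lists C"] exI[of _ R] conjI ballI allI impI)
    show "countable (UNIV \<times> lists C :: (nat \<times> 'a list) set)"
      using C(1) by simp
    show "\<exists>t\<in>UNIV \<times> lists C. R f t" if f: "f \<in> carrier (Aut G T)" for f
    proof -
      obtain i where i: "N i \<subseteq> {v \<in> carrier G. f v \<in> W}"
        using N(2)[OF Aut_identity_nbhd[OF f W(1)]] by blast
      have "\<forall>y\<in>set (xs i). \<exists>c\<in>C. (f y, c) \<in> lower_entourage G W"
        using approx Aut_apply_closed(1)[OF f] xs(1) by blast
      then obtain \<phi> where \<phi>: "\<And>y. y \<in> set (xs i) \<Longrightarrow> \<phi> y \<in> C \<and> (f y, \<phi> y) \<in> lower_entourage G W"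
        by metis
      have "R f (i, map \<phi> (xs i))"
        using i \<phi> by (auto simp: R_def list_all2_map2 intro!: list.rel_refl_strong)
      moreover have "map \<phi> (xs i) \<in> lists C"
        using \<phi> by auto
      ultimately show ?thesis
        by blast
    qed
    show "(f x, g x) \<in> lower_entourage G V"
      if f: "f \<in> carrier (Aut G T)" "R f t" and g: "g \<in> carrier (Aut G T)" "R g t" and x: "x \<in> B"
      for f g t x
    proof -
      obtain i cs where t: "t = (i, cs)"
        by fastforce
      obtain k where k: "k < length (xs i)" "(x, xs i ! k) \<in> lower_entourage G (N i)"
        using xs(2)[OF x, of i] by (metis in_set_conv_nth)
      have "(f (xs i ! k), cs ! k) \<in> lower_entourage G W" "(g (xs i ! k), cs ! k) \<in> lower_entourage G W"
        using f(2) g(2) k(1) unfolding t R_def by (auto dest: list_all2_nthD)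
      then have "(f x, cs ! k) \<in> lower_entourage G V'" "(g x, cs ! k) \<in> lower_entourage G V'"
        using near f g k(2) unfolding t by blast+
      then show ?thesis
        using lower_entourage_trans'[OF V'G V'(3)] lower_entourage_sym[OF V'G V'(2)] by blast
    qed
  qed
qed

text \<open>For each pair of a bounded set \<open>P k\<close> and a neighborhood \<open>N j\<close>, one automorphism is selected for each pair
  of labels that occurs for some \<open>f\<close> and its inverse; the union over all \<open>k\<close> and \<open>j\<close> is dense.\<close>

theorem Aut_separable:
  assumes sep: "separable_space T"
    and N: "\<And>n. identity_nbhd G T (N n)" "\<And>V. identity_nbhd G T V \<Longrightarrow> \<exists>n::nat. N n \<subseteq> V"
    and P: "\<And>n. roelcke_precompact G T (P n)" "\<And>B. group_bounded G T B \<Longrightarrow> \<exists>n::nat. B \<subseteq> P n"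
  shows "separable_space (lower_topology G T)"
proof -
  let ?A = "Aut G T"
  have "\<exists>D. countable D \<and> D \<subseteq> carrier ?A \<and> (\<forall>g\<in>carrier ?A. \<exists>h\<in>D. h \<in> lower_nbhd G T (P k) (N j) g)" for k j
  proof -
    obtain \<Theta> :: "(nat \<times> 'a list) set" and R where R: "countable \<Theta>" "\<forall>f\<in>carrier ?A. \<exists>t\<in>\<Theta>. R f t"
        "\<forall>f\<in>carrier ?A. \<forall>g\<in>carrier ?A. \<forall>t. \<forall>x\<in>P k. R f t \<longrightarrow> R g t \<longrightarrow>
          (f x, g x) \<in> lower_entourage G (N j)"
      by atomize_elim (rule Aut_countable_approximation[OF sep N P(1) N(1)])
    define Q where "Q f p \<longleftrightarrow> f \<in> carrier ?A \<and> R f (fst p) \<and> R (inv\<^bsub>?A\<^esub> f) (snd p)" for f p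
    define D where "D = (\<lambda>p. SOME f. Q f p) ` {p \<in> \<Theta> \<times> \<Theta>. \<exists>f. Q f p}"
    have "countable D"
      using R(1) by (simp add: D_def)
    moreover have "D \<subseteq> carrier ?A"
    proof
      fix h assume "h \<in> D"
      then obtain p where "\<exists>f. Q f p" "h = (SOME f. Q f p)"
        unfolding D_def by blast
      then have "Q h p"
        using someI_ex[of "\<lambda>f. Q f p"] by simp
      then show "h \<in> carrier ?A"
        by (simp add: Q_def)
    qed
    moreover have "\<exists>h\<in>D. h \<in> lower_nbhd G T (P k) (N j) g" if g: "g \<in> carrier ?A" for g
    proof -
      obtain t t' where t: "t \<in> \<Theta>" "t' \<in> \<Theta>" "Q g (t, t')"
        using bspec[OF R(2) g] bspec[OF R(2) Aut_inv_closed[OF g]] g by (auto simp: Q_def)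
      define h where "h = (SOME f. Q f (t, t'))"
      have "h \<in> D"
        using t by (auto simp: D_def h_def)
      moreover have h: "Q h (t, t')"
        unfolding h_def using t(3) by (rule someI[of "\<lambda>f. Q f (t, t')"])
      moreover have "h \<in> lower_nbhd G T (P k) (N j) g"
        unfolding lower_nbhd_iff[OF g roelcke_precompactD(1)[OF P(1)]]
      proof (intro conjI ballI)
        have hA: "h \<in> carrier ?A" "R h t" "R (inv\<^bsub>?A\<^esub> h) t'" and gR: "R g t" "R (inv\<^bsub>?A\<^esub> g) t'"
          using h t(3) by (simp_all add: Q_def)
        show "h \<in> carrier ?A"
          by (rule hA(1))
        fix x assume x: "x \<in> P k"
        show "(h x, g x) \<in> lower_entourage G (N j)"
          using R(3) hA(1) g x hA(2) gR(1) by blast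
        show "((inv\<^bsub>?A\<^esub> h) x, (inv\<^bsub>?A\<^esub> g) x) \<in> lower_entourage G (N j)"
          using R(3) Aut_inv_closed[OF hA(1)] Aut_inv_closed[OF g] x hA(3) gR(2) by blast
      qed
      ultimately show ?thesis
        by blast
    qed
    ultimately show ?thesis
      by blast
  qed
  then obtain D where D: "\<And>k j. countable (D k j)" "\<And>k j. D k j \<subseteq> carrier ?A"
      "\<And>k j g. g \<in> carrier ?A \<Longrightarrow> \<exists>h\<in>D k j. h \<in> lower_nbhd G T (P k) (N j) g"
    by metis
  define E where "E = (\<Union>k. \<Union>j. D k j)"
  have "E \<inter> \<U> \<noteq> {}" if \<U>: "openin (lower_topology G T) \<U>" "\<U> \<noteq> {}" for \<U>
  proof -
    obtain g where g: "g \<in> \<U>"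
      using \<U>(2) by blast
    then obtain B V where BV: "group_bounded G T B" "identity_nbhd G T V" "lower_nbhd G T B V g \<subseteq> \<U>"
      using \<U>(1) unfolding openin_lower_topology by blast
    obtain k j where kj: "B \<subseteq> P k" "N j \<subseteq> V"
      using P(2)[OF BV(1)] N(2)[OF BV(2)] by blast
    have "g \<in> carrier ?A"
      using \<U>(1) g unfolding openin_lower_topology by blast
    then obtain h where "h \<in> D k j" "h \<in> lower_nbhd G T (P k) (N j) g"
      using D(3) by blast
    then show ?thesis
      using lower_nbhd_mono[OF kj] BV(3) unfolding E_def by blast
  qed
  moreover have "countable E"
    using D(1) by (simp add: E_def)
  moreover have "E \<subseteq> topspace (lower_topology G T)"
    using D(2) unfolding E_def topspace_lower_topology by blast
  ultimately show ?thesis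
    unfolding separable_space_def dense_intersects_open by blast
qed

lemma Aut_separated:
  assumes Haus: "Hausdorff_space T"
    and f: "f \<in> carrier (Aut G T)" "\<And>V. identity_nbhd (Aut G T) (lower_topology G T) V \<Longrightarrow> f \<in> V"
  shows "f = \<one>\<^bsub>Aut G T\<^esub>"
proof -
  let ?A = "Aut G T"
  interpret A: group ?A
    by (rule group_Aut)
  have "f x = x" if x: "x \<in> carrier G" for x
  proof (rule ccontr)
    assume "f x \<noteq> x"
    then obtain O' where O': "openin T O'" "x \<in> O'" "f x \<notin> O'"
      using Haus Aut_apply_closed(1)[OF f(1) x] x unfolding Hausdorff_space_def disjnt_iff by (metis in_topspace_iff)
    then obtain V where V: "identity_nbhd G T V" "\<And>y. y \<in> carrier G \<Longrightarrow> inv x \<otimes> y \<in> V \<Longrightarrow> y \<in> O'"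
      unfolding openin_iff_identity_nbhd by blast
    obtain W where W: "identity_nbhd G T W" "\<And>y. (y, x) \<in> lower_entourage G W \<Longrightarrow> inv x \<otimes> y \<in> V"
      using lower_entourage_topology[OF V(1) x] by metis
    have B: "group_bounded G T {x}"
      using x unfolding group_bounded_def by fast
    have "(f x, x) \<in> lower_entourage G W"
      using f(2)[OF lower_nbhd_identity_nbhd[OF B W(1)]] x
      unfolding lower_nbhd_iff[OF A.one_closed group_boundedD[OF B]] by (simp add: Aut_one_apply)
    then show False
      using W(2) V(2) O'(3) Aut_apply_closed(1)[OF f(1) x] by blast
  qed
  moreover have "f \<in> extensional (carrier G)" "\<one>\<^bsub>?A\<^esub> \<in> extensional (carrier G)"
    using f(1) A.one_closed unfolding Aut_iff by blast+
  ultimately show ?thesis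
    by (intro extensionalityI[of _ "carrier G"]) (simp_all add: Aut_one_apply)
qed

end

section \<open>The automorphism group is Polish\<close>

theorem corollary3p16:
  fixes G :: "('a, 'b) monoid_scheme" and T :: "'a topology"
  assumes "polish_group G T"
    and "locally_roelcke_precompact G T"
  shows "polish_group (Aut G T) (lower_topology G T)"
proof -
  let ?A = "Aut G T" and ?S = "lower_topology G T"
  interpret topological_group G T
    using assms(1) unfolding polish_group_def by blast
  have sep: "separable_space T" and cm: "completely_metrizable_space T"
    using assms(1) unfolding polish_group_def by blast+
  have metrizable: "metrizable_space T"
    using cm by (rule completely_metrizable_imp_metrizable_space)
  then have Haus: "Hausdorff_space T"
    by (rule metrizable_imp_Hausdorff_space)
  obtain N where N: "\<And>n. identity_nbhd G T (N n)" "\<And>V. identity_nbhd G T V \<Longrightarrow> \<exists>n::nat. N n \<subseteq> V"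
    using nbhd_base_of_metrizable[OF metrizable] by blast
  obtain U where U: "identity_nbhd G T U" "roelcke_precompact G T U"
    using assms(2) unfolding locally_roelcke_precompact_def by blast
  obtain P where P: "\<And>n. roelcke_precompact G T (P n)" "\<And>B. group_bounded G T B \<Longrightarrow> \<exists>n::nat. B \<subseteq> P n"
    using roelcke_precompact_exhaustion[OF sep U] by blast
  have U_bdd: "group_bounded G T U"
    using U(2) by (rule roelcke_precompact_imp_group_bounded)
  interpret A: topological_group ?A ?S
    by (rule topological_group_Aut[OF U(1) U_bdd])
  define M where "M n = (case prod_decode n of (k, j) \<Rightarrow> lower_nbhd G T (P k) (N j) \<one>\<^bsub>?A\<^esub>)" for n
  have "completely_metrizable_space ?S"
  proof (rule A.two_sided_complete_imp_completely_metrizable)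
    show "identity_nbhd ?A ?S (M n)" for n
      using lower_nbhd_identity_nbhd[OF roelcke_precompact_imp_group_bounded[OF P(1)] N(1)]
      by (simp add: M_def split: prod.split)
    show "\<exists>n. M n \<subseteq> V" if V: "identity_nbhd ?A ?S V" for V
    proof -
      obtain \<U> where \<U>: "openin ?S \<U>" "\<one>\<^bsub>?A\<^esub> \<in> \<U>" "\<U> \<subseteq> V"
        using V unfolding identity_nbhd_def by blast
      obtain B W where BW: "group_bounded G T B" "identity_nbhd G T W" "lower_nbhd G T B W \<one>\<^bsub>?A\<^esub> \<subseteq> \<U>"
        using \<U>(1,2) unfolding openin_lower_topology by blast
      obtain k j where kj: "B \<subseteq> P k" "N j \<subseteq> W"
        using P(2)[OF BW(1)] N(2)[OF BW(2)] by blast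
      have "M (prod_encode (k, j)) \<subseteq> V"
        using lower_nbhd_mono[OF kj] BW(3) \<U>(3) by (simp add: M_def) blast
      then show ?thesis
        by blast
    qed
    show "f = \<one>\<^bsub>?A\<^esub>" if "f \<in> carrier ?A" "\<And>V. identity_nbhd ?A ?S V \<Longrightarrow> f \<in> V" for f
      using Haus that by (rule Aut_separated)
    show "\<exists>f. limitin ?S \<sigma> f sequentially" if "two_sided_Cauchy ?A ?S \<sigma>" for \<sigma>
      using Aut_two_sided_complete[OF U(1) U_bdd Haus completely_metrizable_imp_two_sided_complete[OF cm] that] .
  qed
  then show ?thesis
    unfolding polish_group_def using A.topological_group_axioms Aut_separable[OF sep N P] by blast
qed

end
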